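(* Let $r_0>0$, $k\ge2$, $m>0$ with $m\ne1$, and let $\overline M=\overline{B_{r_0}(0)}$ be a closed geodesic ball of radius $r_0$ in $(\mathbb{H}^2,g_{-1})$, $g_{-1}=dr^2+\sinh^2(r)d\theta^2$, with interior $M$ and boundary $\partial M$. Let $\xi(t)=1+e^{-2t}(m-1)$ and $\eta(t)=\xi(t)^{-1/2}\frac{\cosh r_0}{\sinh r_0}+\rho(t)$, where $\rho\in C^k([0,\infty))$ satisfies $\rho(0)=\rho^{(j)}(0)=0$ for $1\le j\le k$, $\rho'(t)\ge0$ for $t\ge0$, and $\rho'(t)>0$ for $t\in(0,t_1)$ for some $t_1>0$; if $m>1$ assume also $\rho'(t)\ge(1-\xi(t)^{-1})\rho(t)$ for $t\ge0$. Let $g(t)$, $t\in[0,T)$ with $T$ the maximal existence time, be the solution of $\partial_tg=-2(K_g+1)g$ in $\overline M$, $k_g=\eta$ on $\partial M$, $g(0)=mg_{-1}$. Let $F_1=K_{g(t)}+\xi(t)^{-1}$. Then $F_1\le0$ on $\overline M\times[0,T)$, and $F_1<0$ on $\overline M\times(0,T)$.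
   Context: $K_g$ is the Gaussian curvature of $g$ and $k_g$ the geodesic curvature of $\partial M$ with respect to $g$. The solution is rotationally symmetric, $g(t)=a(r,t)^2dr^2+b(r,t)^2d\theta^2$, and $K_g=-b^{-1}\partial_s^2 b$ with $s$ the $g(t)$-distance to the origin. *)

theory Defs
  imports "HOL-Analysis.Analysis"
begin

text \<open>
Model: the hyperbolic plane is realised as the Poincare disk, i.e. the open unit disk in
R^2 = real \<times> real with g_{-1} = 4/(1-|x|^2)^2 |dx|^2.  The closed geodesic ball of
hyperbolic radius r0 about the origin is the Euclidean closed disk of radius tanh(r0/2).
Since the flow equation d/dt g = -2(K+1) g is, pointwise, a scalar ODE for the metric,
every solution stays conformal to its initial metric; we write g(t) = exp(2 v(x,t)) |dx|^2.
\<close>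

definition geo_ball :: "real \<Rightarrow> (real \<times> real) set" where
  "geo_ball r0 = cball 0 (tanh (r0 / 2))"

definition hyp_factor :: "real \<times> real \<Rightarrow> real" where
  "hyp_factor p = 4 / (1 - (norm p)\<^sup>2)\<^sup>2"

text \<open>Classical C^{2,1} regularity on D \<times> [0,T): G is the spatial gradient of v,
H1, H2 the gradients of the two components of G (rows of the Hessian), vt the time
derivative; all derivatives are taken within the closed domain and are jointly continuous.\<close>

definition C21_on ::
  "(real \<times> real) set \<Rightarrow> real \<Rightarrow> (real \<times> real \<Rightarrow> real \<Rightarrow> real)
   \<Rightarrow> (real \<times> real \<Rightarrow> real \<Rightarrow> real \<times> real) \<Rightarrow> (real \<times> real \<Rightarrow> real \<Rightarrow> real \<times> real)
   \<Rightarrow> (real \<times> real \<Rightarrow> real \<Rightarrow> real \<times> real) \<Rightarrow> (real \<times> real \<Rightarrow> real \<Rightarrow> real) \<Rightarrow> bool" where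
  "C21_on D T v G H1 H2 vt \<longleftrightarrow>
     (\<forall>t\<in>{0..<T}. \<forall>p\<in>D.
        ((\<lambda>q. v q t) has_derivative (\<lambda>h. G p t \<bullet> h)) (at p within D) \<and>
        ((\<lambda>q. fst (G q t)) has_derivative (\<lambda>h. H1 p t \<bullet> h)) (at p within D) \<and>
        ((\<lambda>q. snd (G q t)) has_derivative (\<lambda>h. H2 p t \<bullet> h)) (at p within D) \<and>
        ((\<lambda>s. v p s) has_real_derivative vt p t) (at t within {0..<T})) \<and>
     continuous_on (D \<times> {0..<T}) (\<lambda>(p, t). v p t) \<and>
     continuous_on (D \<times> {0..<T}) (\<lambda>(p, t). G p t) \<and>
     continuous_on (D \<times> {0..<T}) (\<lambda>(p, t). H1 p t) \<and>
     continuous_on (D \<times> {0..<T}) (\<lambda>(p, t). H2 p t) \<and>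
     continuous_on (D \<times> {0..<T}) (\<lambda>(p, t). vt p t)"

text \<open>Gaussian curvature of exp(2v)|dx|^2: K = - exp(-2v) (v_xx + v_yy).\<close>
definition gauss_curv ::
  "(real \<times> real \<Rightarrow> real \<Rightarrow> real) \<Rightarrow> (real \<times> real \<Rightarrow> real \<Rightarrow> real \<times> real)
   \<Rightarrow> (real \<times> real \<Rightarrow> real \<Rightarrow> real \<times> real) \<Rightarrow> real \<times> real \<Rightarrow> real \<Rightarrow> real" where
  "gauss_curv v H1 H2 p t = - exp (-2 * v p t) * (fst (H1 p t) + snd (H2 p t))"

text \<open>Geodesic curvature of the circle |p| = R (w.r.t. the inward normal, positive for
round circles) for the metric exp(2v)|dx|^2: k = exp(-v) (1/R + dv/d\<nu>), \<nu> = p/R.\<close>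
definition geod_curv ::
  "real \<Rightarrow> (real \<times> real \<Rightarrow> real \<Rightarrow> real) \<Rightarrow> (real \<times> real \<Rightarrow> real \<Rightarrow> real \<times> real)
   \<Rightarrow> real \<times> real \<Rightarrow> real \<Rightarrow> real" where
  "geod_curv R v G p t = exp (- v p t) * (1 / R + G p t \<bullet> (p /\<^sub>R R))"

definition xi :: "real \<Rightarrow> real \<Rightarrow> real" where
  "xi m t = 1 + exp (-2 * t) * (m - 1)"

definition eta :: "real \<Rightarrow> real \<Rightarrow> (real \<Rightarrow> real) \<Rightarrow> real \<Rightarrow> real" where
  "eta m r0 \<rho> t = (1 / sqrt (xi m t)) * (cosh r0 / sinh r0) + \<rho> t"

end

(*
  Dividing g(t) by xi(t) and substituting time by s with dt/ds = xi turns the problem into the flow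
  u_s = exp(-2u) Lap u - 1 started at the stationary hyperbolic metric, with boundary curvature
  h = coth r0 + sqrt(xi) rho, and F_1 = - u_s / xi.  The hypotheses on rho say that h is
  nondecreasing.  So u(s) >= u(0) by comparison with the stationary solution, and then
  u(s + delta) >= u(s) by comparison of the solution with its time translate; hence u_s >= 0.
  For strictness, u(s + delta) - u(s) is bounded below by delta times a barrier independent of
  delta: first a plane wave, on a short time interval where h grows at a definite rate, then an
  exponentially decaying constant.  Working with difference quotients avoids differentiating the
  curvature, for which C^{2,1} regularity does not suffice.
*)
theory Submission
  imports Defs
begin

subsection \<open>Closure properties of the regularity class\<close>

text \<open>Let w be the difference of the translate U = u(s + delta) and u. Subtracting the
  equations gives w_s = exp(-2U) Lap w + (exp(-2U) - exp(-2u)) Lap u, and once w >= 0 is known the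
  last term is at least -B w, with B independent of delta. The conditions on a lower barrier for w
  (differential inequality, initial value, boundary flux of order delta) then scale linearly with
  delta, so the resulting bound can be divided by delta. Two barriers are needed because h grows at
  a definite rate only on a short interval: there the flux pays for a wave that reaches every point
  of the disk, while later only a barrier without flux is admissible. Both are bounded below on the
  closed disk, so strictness holds on the boundary circle too. The hypotheses on rho enter through
  h' = xi^(3/2) (rho' - (1 - 1/xi) rho), the derivative being taken in s: for m > 1 the extra
  assumption is exactly h' >= 0, and for m < 1 one has xi <= 1 and rho >= 0.\<close>

lemma C21_onD:
  assumes "C21_on D T v G H1 H2 vt" "p \<in> D" "t \<in> {0..<T}"
  shows "((\<lambda>q. v q t) has_derivative (\<lambda>h. G p t \<bullet> h)) (at p within D)"
    and "((\<lambda>q. fst (G q t)) has_derivative (\<lambda>h. H1 p t \<bullet> h)) (at p within D)"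
    and "((\<lambda>q. snd (G q t)) has_derivative (\<lambda>h. H2 p t \<bullet> h)) (at p within D)"
    and "((\<lambda>s. v p s) has_real_derivative vt p t) (at t within {0..<T})"
  using assms unfolding C21_on_def by blast+

lemma C21_on_continuous:
  assumes "C21_on D T v G H1 H2 vt"
  shows "continuous_on (D \<times> {0..<T}) (\<lambda>x. v (fst x) (snd x))"
    and "continuous_on (D \<times> {0..<T}) (\<lambda>x. G (fst x) (snd x))"
    and "continuous_on (D \<times> {0..<T}) (\<lambda>x. H1 (fst x) (snd x))"
    and "continuous_on (D \<times> {0..<T}) (\<lambda>x. H2 (fst x) (snd x))"
    and "continuous_on (D \<times> {0..<T}) (\<lambda>x. vt (fst x) (snd x))"
  using assms unfolding C21_on_def case_prod_unfold by blast+

text \<open>Serves three substitutions: time translates, the stationary extension of the initial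
  data (constant \<open>\<theta>\<close>), and the rescaled flow. A summand depending on time alone
  leaves the spatial derivatives as they are. Time derivatives are relative to a half-open interval,
  hence the chain rule along the image of \<open>\<theta>\<close>.\<close>

lemma C21_on_time_change:
  assumes reg: "C21_on D T v G H1 H2 vt"
    and maps: "\<And>s. s \<in> {0..<T'} \<Longrightarrow> \<theta> s \<in> {0..<T}"
    and d\<theta>: "\<And>s. s \<in> {0..<T'} \<Longrightarrow> (\<theta> has_real_derivative \<theta>' s) (at s within {0..<T'})"
    and df: "\<And>s. s \<in> {0..<T'} \<Longrightarrow> (f has_real_derivative f' s) (at s within {0..<T'})"
    and c\<theta>': "continuous_on {0..<T'} \<theta>'" and cf': "continuous_on {0..<T'} f'"
  shows "C21_on D T' (\<lambda>p s. v p (\<theta> s) + f s) (\<lambda>p s. G p (\<theta> s)) (\<lambda>p s. H1 p (\<theta> s))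
    (\<lambda>p s. H2 p (\<theta> s)) (\<lambda>p s. vt p (\<theta> s) * \<theta>' s + f' s)"
proof -
  have c\<theta>: "continuous_on {0..<T'} \<theta>" and cf: "continuous_on {0..<T'} f"
    by (rule DERIV_continuous_on[OF d\<theta>] DERIV_continuous_on[OF df]; assumption)+
  have comp: "continuous_on (D \<times> {0..<T'}) (\<lambda>(p, s). g p (\<theta> s))"
    if "continuous_on (D \<times> {0..<T}) (\<lambda>(p, t). g p t)"
    for g :: "real \<times> real \<Rightarrow> real \<Rightarrow> 'a::topological_space"
  proof -
    have "continuous_on (D \<times> {0..<T'}) (\<lambda>x. (fst x, \<theta> (snd x)))"
      by (intro continuous_intros continuous_on_compose2[OF c\<theta>]) auto
    from continuous_on_compose2[OF that this]
    show ?thesis using maps by (force simp: case_prod_unfold)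
  qed
  have lift: "continuous_on (D \<times> {0..<T'}) (\<lambda>(p, s). g s)"
    if "continuous_on {0..<T'} g" for g :: "real \<Rightarrow> real"
    unfolding case_prod_unfold by (intro continuous_on_compose2[OF that] continuous_intros) auto
  have dt: "((\<lambda>s. v p (\<theta> s) + f s) has_real_derivative vt p (\<theta> s) * \<theta>' s + f' s) (at s within {0..<T'})"
    if "p \<in> D" "s \<in> {0..<T'}" for p s
  proof -
    have "((\<lambda>t. v p t) has_real_derivative vt p (\<theta> s)) (at (\<theta> s) within {0..<T})"
      using reg maps that unfolding C21_on_def by blast
    then have "((\<lambda>t. v p t) has_real_derivative vt p (\<theta> s)) (at (\<theta> s) within \<theta> ` {0..<T'})"
      using maps by (auto intro: has_field_derivative_subset)
    from DERIV_image_chain[OF this d\<theta>[OF that(2)]] df[OF that(2)]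
    show ?thesis unfolding comp_def by (rule DERIV_add)
  qed
  show ?thesis
    unfolding C21_on_def
  proof (intro conjI ballI)
    have *: "continuous_on (D \<times> {0..<T'}) (\<lambda>x. v (fst x) (\<theta> (snd x)))"
      "continuous_on (D \<times> {0..<T'}) (\<lambda>x. vt (fst x) (\<theta> (snd x)))"
      using comp[of v] comp[of vt] reg unfolding C21_on_def case_prod_unfold by blast+
    show "continuous_on (D \<times> {0..<T'}) (\<lambda>(p, t). v p (\<theta> t) + f t)"
      using * lift[OF cf] unfolding case_prod_unfold by (intro continuous_intros)
    show "continuous_on (D \<times> {0..<T'}) (\<lambda>(p, t). vt p (\<theta> t) * \<theta>' t + f' t)"
      using * lift[OF cf'] lift[OF c\<theta>'] unfolding case_prod_unfold by (intro continuous_intros)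
  next
    fix s p assume "s \<in> {0..<T'}" "p \<in> D"
    then have "((\<lambda>q. v q (\<theta> s)) has_derivative (\<lambda>h. G p (\<theta> s) \<bullet> h)) (at p within D)"
      using reg maps unfolding C21_on_def by blast
    from has_derivative_add[OF this has_derivative_const]
    show "((\<lambda>q. v q (\<theta> s) + f s) has_derivative (\<lambda>h. G p (\<theta> s) \<bullet> h)) (at p within D)" by simp
  qed (use reg maps dt comp[of G] comp[of H1] comp[of H2] in \<open>auto simp: C21_on_def\<close>)
qed

lemma C21_on_shift:
  assumes "C21_on D T v G H1 H2 vt" "0 \<le> a" "T' \<le> T - a"
  shows "C21_on D T' (\<lambda>p s. v p (s + a)) (\<lambda>p s. G p (s + a)) (\<lambda>p s. H1 p (s + a))
    (\<lambda>p s. H2 p (s + a)) (\<lambda>p s. vt p (s + a))"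
proof -
  have "C21_on D T' (\<lambda>p s. v p (s + a) + 0) (\<lambda>p s. G p (s + a)) (\<lambda>p s. H1 p (s + a))
    (\<lambda>p s. H2 p (s + a)) (\<lambda>p s. vt p (s + a) * 1 + 0)"
    by (rule C21_on_time_change[OF assms(1)])
      (use assms in \<open>auto intro!: derivative_eq_intros continuous_intros\<close>)
  then show ?thesis by simp
qed

lemma C21_on_static:
  assumes "C21_on D T v G H1 H2 vt" "0 < T"
  shows "C21_on D T' (\<lambda>p s. v p 0) (\<lambda>p s. G p 0) (\<lambda>p s. H1 p 0) (\<lambda>p s. H2 p 0) (\<lambda>p s. 0)"
proof -
  have "C21_on D T' (\<lambda>p s. v p ((\<lambda>_. 0) s) + 0) (\<lambda>p s. G p ((\<lambda>_. 0) s)) (\<lambda>p s. H1 p ((\<lambda>_. 0) s))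
    (\<lambda>p s. H2 p ((\<lambda>_. 0) s)) (\<lambda>p s. vt p ((\<lambda>_. 0) s) * 0 + 0)"
    by (rule C21_on_time_change[OF assms(1)])
      (use assms in \<open>auto intro!: derivative_eq_intros continuous_intros\<close>)
  then show ?thesis by simp
qed

lemma C21_on_diff:
  assumes "C21_on D T v G H1 H2 vt" and "C21_on D T v' G' H1' H2' vt'"
  shows "C21_on D T (\<lambda>p s. v p s - v' p s) (\<lambda>p s. G p s - G' p s) (\<lambda>p s. H1 p s - H1' p s)
    (\<lambda>p s. H2 p s - H2' p s) (\<lambda>p s. vt p s - vt' p s)"
  unfolding C21_on_def case_prod_unfold inner_diff_left fst_diff snd_diff
  by (intro conjI ballI continuous_on_diff has_derivative_diff DERIV_diff
      C21_onD[OF assms(1)] C21_onD[OF assms(2)] C21_on_continuous[OF assms(1)]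
      C21_on_continuous[OF assms(2)])

text \<open>One family supplies every explicit test function: the radial weight of the minimum
  principle (\<open>\<beta> = 0\<close>), the plane wave (\<open>\<gamma> = 0\<close>) and the
  decaying constant (both zero).\<close>

lemma C21_on_exp:
  fixes \<kappa> \<alpha> \<beta> \<gamma> d :: real
  defines "E \<equiv> \<lambda>p s. \<kappa> * exp (\<alpha> * s + \<beta> * fst p + \<gamma> * (p \<bullet> p))"
  shows "C21_on D T (\<lambda>p s. E p s + d)
    (\<lambda>p s. E p s *\<^sub>R (\<beta> + 2 * \<gamma> * fst p, 2 * \<gamma> * snd p))
    (\<lambda>p s. E p s *\<^sub>R ((\<beta> + 2 * \<gamma> * fst p)\<^sup>2 + 2 * \<gamma>, (\<beta> + 2 * \<gamma> * fst p) * (2 * \<gamma> * snd p)))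
    (\<lambda>p s. E p s *\<^sub>R ((\<beta> + 2 * \<gamma> * fst p) * (2 * \<gamma> * snd p), (2 * \<gamma> * snd p)\<^sup>2 + 2 * \<gamma>))
    (\<lambda>p s. \<alpha> * E p s)"
proof -
  have dE: "((\<lambda>q. E q t) has_derivative
      (\<lambda>h. E p t * ((\<beta> + 2 * \<gamma> * fst p) * fst h + 2 * \<gamma> * snd p * snd h))) (at p within D)" for p t
    unfolding E_def inner_prod_def
    by (auto intro!: derivative_eq_intros simp: algebra_simps)
  show ?thesis
    unfolding C21_on_def case_prod_unfold
  proof (intro conjI ballI)
    fix t p assume "t \<in> {0..<T}" "p \<in> D"
    show "((\<lambda>q. E q t + d) has_derivative (\<lambda>h. (E p t *\<^sub>R (\<beta> + 2 * \<gamma> * fst p, 2 * \<gamma> * snd p)) \<bullet> h)) (at p within D)"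
      by (rule derivative_eq_intros dE refl | simp add: inner_prod_def algebra_simps fun_eq_iff)+
    show "((\<lambda>q. fst (E q t *\<^sub>R (\<beta> + 2 * \<gamma> * fst q, 2 * \<gamma> * snd q))) has_derivative
       (\<lambda>h. (E p t *\<^sub>R ((\<beta> + 2 * \<gamma> * fst p)\<^sup>2 + 2 * \<gamma>, (\<beta> + 2 * \<gamma> * fst p) * (2 * \<gamma> * snd p))) \<bullet> h)) (at p within D)"
      by (auto intro!: derivative_eq_intros dE simp: inner_prod_def algebra_simps fun_eq_iff power2_eq_square)
    show "((\<lambda>q. snd (E q t *\<^sub>R (\<beta> + 2 * \<gamma> * fst q, 2 * \<gamma> * snd q))) has_derivative
       (\<lambda>h. (E p t *\<^sub>R ((\<beta> + 2 * \<gamma> * fst p) * (2 * \<gamma> * snd p), (2 * \<gamma> * snd p)\<^sup>2 + 2 * \<gamma>)) \<bullet> h)) (at p within D)"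
      by (auto intro!: derivative_eq_intros dE simp: inner_prod_def algebra_simps fun_eq_iff power2_eq_square)
    show "((\<lambda>s. E p s + d) has_real_derivative \<alpha> * E p t) (at t within {0..<T})"
      unfolding E_def by (auto intro!: derivative_eq_intros)
  qed (auto simp: E_def intro!: continuous_intros)
qed

subsection \<open>Minimum and comparison principles\<close>

text \<open>If \<open>l\<close> were negative, \<open>g\<close>, which vanishes at \<open>a\<close>,
  would be negative just to the right of it, and the mean value theorem would push \<open>f\<close>
  below its minimum.\<close>

lemma second_derivative_nonneg_at_min:
  fixes f g :: "real \<Rightarrow> real"
  assumes "0 < e" and df: "\<And>x. \<bar>x - a\<bar> < e \<Longrightarrow> (f has_real_derivative g x) (at x)"
    and dg: "(g has_real_derivative l) (at a)"
    and min: "\<And>x. \<bar>x - a\<bar> < e \<Longrightarrow> f a \<le> f x"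
  shows "0 \<le> l"
proof (rule ccontr)
  assume "\<not> 0 \<le> l"
  have g0: "g a = 0"
    by (rule DERIV_local_min[OF df]) (use assms in \<open>auto simp: abs_minus_commute\<close>)
  obtain d where d: "0 < d" "\<And>h. 0 < h \<Longrightarrow> h < d \<Longrightarrow> g (a + h) < g a"
    using has_real_derivative_neg_dec_right[OF dg] \<open>\<not> 0 \<le> l\<close> by auto
  define h where "h = min d e / 2"
  have h: "0 < h" "h < d" "h < e" using d \<open>0 < e\<close> by (auto simp: h_def)
  obtain z where z: "a < z" "z < a + h" "f (a + h) - f a = (a + h - a) * g z"
    using MVT2[of a "a + h" f g] df h by auto
  have "g z < 0" using d(2)[of "z - a"] z h g0 by auto
  then have "f (a + h) < f a" using z(3) h mult_pos_neg[of h "g z"] by auto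
  then show False using min[of "a + h"] h by auto
qed

text \<open>The one-variable test along the two coordinate lines through \<open>p\<close> makes both
  diagonal Hessian entries nonnegative. Within distance \<open>R - norm p\<close> of
  \<open>p\<close> these lines stay in the open disk, where derivatives within the closed disk are
  full derivatives.\<close>

lemma C21_on_min_interior:
  assumes reg: "C21_on (cball 0 R) T z Z H1 H2 zt" and s: "s \<in> {0..<T}" and p: "norm p < R"
    and min: "\<And>q. q \<in> cball 0 R \<Longrightarrow> z p s \<le> z q s"
  shows "0 \<le> fst (H1 p s) + snd (H2 p s)"
proof -
  define e where "e = R - norm p"
  have e: "0 < e" using p by (simp add: e_def)
  obtain x y where xy: "p = (x, y)" by (cases p)
  have nn: "norm q < R" if "norm (q - p) < e" for q
    using norm_triangle_sub[of q p] that by (simp add: e_def)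
  have at: "at q within cball 0 R = at q" if "norm q < R" for q :: "real \<times> real"
    using at_within_interior[of q "cball 0 R"] that by (simp add: interior_cball)
  have D: "((\<lambda>q. z q s) has_derivative (\<lambda>h. Z q s \<bullet> h)) (at q)"
    "((\<lambda>q. fst (Z q s)) has_derivative (\<lambda>h. H1 q s \<bullet> h)) (at q)"
    "((\<lambda>q. snd (Z q s)) has_derivative (\<lambda>h. H2 q s \<bullet> h)) (at q)" if "norm q < R" for q
    using C21_onD[OF reg _ s, of q] at[OF that] that by simp_all
  have X: "((\<lambda>x. f (x, y)) has_real_derivative v \<bullet> (1, 0)) (at x)"
    if "(f has_derivative (\<lambda>h. v \<bullet> h)) (at (x, y))" for f :: "real \<times> real \<Rightarrow> real" and v x y
  proof -
    have "((\<lambda>x. (x, y)) has_derivative (\<lambda>h. (h, 0))) (at x)"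
      by (auto intro!: derivative_eq_intros)
    from has_derivative_compose[OF this that]
    show ?thesis
      by (simp add: has_field_derivative_def inner_prod_def mult_commute_abs)
  qed
  have Y: "((\<lambda>y. f (x, y)) has_real_derivative v \<bullet> (0, 1)) (at y)"
    if "(f has_derivative (\<lambda>h. v \<bullet> h)) (at (x, y))" for f :: "real \<times> real \<Rightarrow> real" and v x y
  proof -
    have "((\<lambda>y. (x, y)) has_derivative (\<lambda>h. (0, h))) (at y)"
      by (auto intro!: derivative_eq_intros)
    from has_derivative_compose[OF this that]
    show ?thesis
      by (simp add: has_field_derivative_def inner_prod_def mult_commute_abs)
  qed
  have "0 \<le> H1 p s \<bullet> (1, 0)"
  proof (rule second_derivative_nonneg_at_min[OF e])
    fix t assume "\<bar>t - x\<bar> < e"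
    then have *: "norm (t, y) < R" by (intro nn) (simp add: xy norm_Pair)
    show "((\<lambda>x. z (x, y) s) has_real_derivative fst (Z (t, y) s)) (at t)"
      using X[OF D(1)[OF *]] by (simp add: inner_prod_def)
    show "z (x, y) s \<le> z (t, y) s" using min[of "(t, y)"] * by (simp add: xy mem_cball_0)
  next
    show "((\<lambda>t. fst (Z (t, y) s)) has_real_derivative H1 p s \<bullet> (1, 0)) (at x)"
      using X[of "\<lambda>q. fst (Z q s)" "H1 p s" x y] D(2)[OF p] by (simp add: xy)
  qed
  moreover have "0 \<le> H2 p s \<bullet> (0, 1)"
  proof (rule second_derivative_nonneg_at_min[OF e])
    fix t assume "\<bar>t - y\<bar> < e"
    then have *: "norm (x, t) < R" by (intro nn) (simp add: xy norm_Pair)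
    show "((\<lambda>y. z (x, y) s) has_real_derivative snd (Z (x, t) s)) (at t)"
      using Y[OF D(1)[OF *]] by (simp add: inner_prod_def)
    show "z (x, y) s \<le> z (x, t) s" using min[of "(x, t)"] * by (simp add: xy mem_cball_0)
  next
    show "((\<lambda>t. snd (Z (x, t) s)) has_real_derivative H2 p s \<bullet> (0, 1)) (at y)"
      using Y[of "\<lambda>q. snd (Z q s)" "H2 p s" x y] D(3)[OF p] by (simp add: xy)
  qed
  ultimately show ?thesis by (simp add: inner_prod_def)
qed

text \<open>Moving inward along the radius cannot decrease \<open>z\<close>, and the derivative in
  that direction is minus the radial one.\<close>

lemma C21_on_min_boundary:
  assumes reg: "C21_on (cball 0 R) T z Z H1 H2 zt" and s: "s \<in> {0..<T}" and p: "norm p = R"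
    and min: "\<And>q. q \<in> cball 0 R \<Longrightarrow> z p s \<le> z q s"
  shows "Z p s \<bullet> p \<le> 0"
proof (rule ccontr)
  assume neg: "\<not> Z p s \<bullet> p \<le> 0"
  have sub: "(\<lambda>x::real. (1 - x) *\<^sub>R p) ` {0..1} \<subseteq> cball 0 R"
    using p by (auto simp: mult_left_le_one_le simp del: scaleR_collapse)
  have "((\<lambda>q. z q s) has_derivative (\<lambda>h. Z p s \<bullet> h)) (at p within cball 0 R)"
    using C21_onD[OF reg _ s] p by simp
  then have "((\<lambda>q. z q s) has_derivative (\<lambda>h. Z p s \<bullet> h))
      (at ((1 - 0) *\<^sub>R p) within (\<lambda>x::real. (1 - x) *\<^sub>R p) ` {0..1})"
    using sub by (auto intro: has_derivative_subset)
  moreover have "((\<lambda>x. (1 - x) *\<^sub>R p) has_derivative (\<lambda>h. h *\<^sub>R (- p))) (at 0 within {0..1})"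
    by (auto intro!: derivative_eq_intros)
  ultimately have "((\<lambda>x. z ((1 - x) *\<^sub>R p) s) has_derivative (\<lambda>h. Z p s \<bullet> (h *\<^sub>R (- p))))
      (at 0 within {0..1})"
    by (rule has_derivative_in_compose[rotated])
  then have "((\<lambda>x. z ((1 - x) *\<^sub>R p) s) has_real_derivative - (Z p s \<bullet> p)) (at 0 within {0..1})"
    unfolding has_field_derivative_def by (rule has_derivative_eq_rhs) (simp add: fun_eq_iff)
  from has_real_derivative_neg_dec_right[OF this] neg
  obtain d where d: "0 < d" "\<And>h. 0 < h \<Longrightarrow> h \<in> {0..1} \<Longrightarrow> h < d \<Longrightarrow> z ((1 - h) *\<^sub>R p) s < z p s"
    by auto
  define h where "h = min d 1 / 2"
  have h: "0 < h" "h \<le> 1" "h < d" using d by (auto simp: h_def)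
  then have "(1 - h) *\<^sub>R p \<in> cball 0 R" using sub by (meson atLeastAtMost_iff image_subset_iff less_imp_le)
  then show False using d(2)[of h] h min[of "(1 - h) *\<^sub>R p"] by auto
qed

text \<open>The differential inequalities are required only where \<open>z\<close> is negative, so
  applications may use that sign when they estimate lower-order terms. The boundary condition is of
  Robin type with \<open>C\<close> of either sign; the comparison function therefore needs a steep
  outward slope, which a weight depending on time alone could not provide.\<close>

lemma parabolic_minimum_principle:
  assumes R: "0 < R" and reg: "C21_on (cball 0 R) T z Z H1 H2 zt" and s1: "s1 < T"
    and init: "\<And>p. norm p \<le> R \<Longrightarrow> 0 \<le> z p 0"
    and int: "\<And>p s. norm p < R \<Longrightarrow> 0 < s \<Longrightarrow> s \<le> s1 \<Longrightarrow> z p s < 0 \<Longrightarrow>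
      \<exists>a. 0 \<le> a \<and> a \<le> A \<and> a * (fst (H1 p s) + snd (H2 p s)) + B * z p s \<le> zt p s"
    and bdry: "\<And>p s. norm p = R \<Longrightarrow> 0 < s \<Longrightarrow> s \<le> s1 \<Longrightarrow> z p s < 0 \<Longrightarrow> C * z p s \<le> Z p s \<bullet> p"
    and p: "norm p \<le> R" and s: "0 \<le> s" "s \<le> s1"
  shows "0 \<le> z p s"
proof (rule ccontr)
  assume "\<not> 0 \<le> z p s"
  \<comment> \<open>The derivative of \<open>\<gamma> * (p \<bullet> p)\<close> in direction
    \<open>p\<close> is then \<open>\<bar>C\<bar> + 1\<close> on the circle, which exceeds
    \<open>C\<close>.\<close>
  define \<gamma> where "\<gamma> = (\<bar>C\<bar> + 1) / (2 * R\<^sup>2)"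
  have \<gamma>: "0 < \<gamma>" using R by (simp add: \<gamma>_def)
  \<comment> \<open>The Laplacian of the weight is the weight times
    \<open>4 * \<gamma> + 4 * \<gamma>^2 * (p \<bullet> p)\<close>. Growth at rate
    \<open>\<Lambda>\<close> outweighs this for any coefficient up to \<open>A\<close>, and also the
    \<open>B\<close> term, with 1 to spare for strictness.\<close>
  define \<Lambda> where "\<Lambda> = \<bar>A\<bar> * (4 * \<gamma> + 4 * \<gamma>\<^sup>2 * R\<^sup>2) + \<bar>B\<bar> + 1"
  \<comment> \<open>For the least \<epsilon> with - \<epsilon> * W \<le> z the two functions touch, and there the interior or the
    boundary hypothesis is violated.\<close>
  define W where "W = (\<lambda>(p :: real \<times> real) s. exp (\<Lambda> * s + 0 * fst p + \<gamma> * (p \<bullet> p)) :: real)"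
  have W: "0 < W q t" for q t by (simp add: W_def)
  define K where "K = cball (0::real \<times> real) R \<times> {0..s1}"
  have cz: "continuous_on K (\<lambda>(q, t). z q t)"
    using C21_on_continuous(1)[OF reg] s1 unfolding K_def case_prod_unfold
    by (auto elim: continuous_on_subset)
  have "continuous_on K (\<lambda>(q, t). z q t / W q t)"
    using cz W unfolding case_prod_unfold
    by (intro continuous_on_divide) (auto simp: W_def intro!: continuous_intros)
  moreover have "compact K" "K \<noteq> {}" using p s R unfolding K_def by (auto intro!: compact_Times)
  ultimately obtain x0 where x0: "x0 \<in> K"
    "\<And>y. y \<in> K \<Longrightarrow> (\<lambda>(q, t). z q t / W q t) x0 \<le> (\<lambda>(q, t). z q t / W q t) y"
    using continuous_attains_inf[of K "\<lambda>(q, t). z q t / W q t"] by blast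
  obtain q t where qt: "x0 = (q, t)" by (cases x0)
  define \<epsilon> where "\<epsilon> = - (z q t / W q t)"
  have zqt: "z q t = - \<epsilon> * W q t" using W[of q t] by (simp add: \<epsilon>_def)
  have zge: "- \<epsilon> * W q' t' \<le> z q' t'" if "(q', t') \<in> K" for q' t'
    using x0(2)[OF that] W[of q' t'] by (simp add: qt \<epsilon>_def field_simps)
  have \<epsilon>: "0 < \<epsilon>"
  proof (rule ccontr)
    assume "\<not> 0 < \<epsilon>"
    then have "0 \<le> - \<epsilon> * W p s" using W[of p s] by (simp add: mult_nonpos_nonneg)
    then show False using zge[of p s] p s \<open>\<not> 0 \<le> z p s\<close> by (auto simp: K_def)
  qed
  have neg: "z q t < 0" using zqt W[of q t] \<epsilon> by simp
  have q: "norm q \<le> R" and t: "0 \<le> t" "t \<le> s1" using x0(1) by (auto simp: qt K_def)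
  have tpos: "0 < t" using init[OF q] neg t by (cases "t = 0") auto
  define Wg where "Wg = (\<lambda>p s. (- \<epsilon> * W p s) *\<^sub>R (2 * \<gamma> * fst p, 2 * \<gamma> * snd p))"
  define W1 where "W1 = (\<lambda>p s. (- \<epsilon> * W p s) *\<^sub>R ((2 * \<gamma> * fst p)\<^sup>2 + 2 * \<gamma>, (2 * \<gamma> * fst p) * (2 * \<gamma> * snd p)))"
  define W2 where "W2 = (\<lambda>p s. (- \<epsilon> * W p s) *\<^sub>R ((2 * \<gamma> * fst p) * (2 * \<gamma> * snd p), (2 * \<gamma> * snd p)\<^sup>2 + 2 * \<gamma>))"
  have "C21_on (cball 0 R) T (\<lambda>p s. - \<epsilon> * W p s) Wg W1 W2 (\<lambda>p s. \<Lambda> * (- \<epsilon> * W p s))"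
    using C21_on_exp[where \<kappa> = "- \<epsilon>" and \<alpha> = \<Lambda> and \<beta> = 0 and \<gamma> = \<gamma> and d = 0, of "cball 0 R" T]
    unfolding Wg_def W1_def W2_def W_def by simp
  note regW = C21_on_diff[OF reg this]
  have min: "z q t - - \<epsilon> * W q t \<le> z q' t' - - \<epsilon> * W q' t'" if "(q', t') \<in> K" for q' t'
    using zge[OF that] zqt by simp
  have tT: "t \<in> {0..<T}" using t s1 by auto
  \<comment> \<open>\<open>t\<close> may equal \<open>s1\<close>, so the minimum is compared with
    earlier times only; this yields just the one sign that is used.\<close>
  have dt: "zt q t - \<Lambda> * (- \<epsilon> * W q t) \<le> 0"
  proof (rule ccontr)
    assume "\<not> ?thesis"
    then have pos: "0 < zt q t - \<Lambda> * (- \<epsilon> * W q t)" by simp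
    have "((\<lambda>t. z q t - - \<epsilon> * W q t) has_real_derivative zt q t - \<Lambda> * (- \<epsilon> * W q t)) (at t within {0..<T})"
      using C21_onD(4)[OF regW _ tT] q by simp
    from has_real_derivative_pos_inc_left[OF this pos]
    obtain d where d: "0 < d" "\<And>h. 0 < h \<Longrightarrow> t - h \<in> {0..<T} \<Longrightarrow> h < d \<Longrightarrow>
        z q (t - h) - - \<epsilon> * W q (t - h) < z q t - - \<epsilon> * W q t"
      by blast
    define h where "h = min d t / 2"
    have h: "0 < h" "h \<le> t" "h < d" using d tpos by (auto simp: h_def)
    then show False using d(2)[of h] min[of q "t - h"] q t s1 by (auto simp: K_def)
  qed
  have qq: "q \<bullet> q = (norm q)\<^sup>2" by (simp add: power2_norm_eq_inner)
  show False
  proof (cases "norm q = R")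
    case True
    have "(Z q t - Wg q t) \<bullet> q \<le> 0"
      using C21_on_min_boundary[OF regW tT True] min t by (auto simp: K_def)
    moreover have "Wg q t \<bullet> q = - \<epsilon> * W q t * (2 * \<gamma> * (q \<bullet> q))"
      by (simp add: Wg_def inner_prod_def algebra_simps)
    moreover have "2 * \<gamma> * (q \<bullet> q) = \<bar>C\<bar> + 1" using R True by (simp add: qq \<gamma>_def)
    moreover have "C * z q t \<le> Z q t \<bullet> q" using bdry True tpos t neg by blast
    ultimately have "C * (- \<epsilon> * W q t) + \<epsilon> * W q t * (\<bar>C\<bar> + 1) \<le> 0"
      by (simp add: zqt inner_diff_left)
    then have "\<epsilon> * W q t * (\<bar>C\<bar> + 1 - C) \<le> 0" by (simp add: algebra_simps)
    moreover have "0 < \<epsilon> * W q t * (\<bar>C\<bar> + 1 - C)" using \<epsilon> W[of q t] by (intro mult_pos_pos) auto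
    ultimately show False by simp
  next
    case False
    then have qR: "norm q < R" using q by simp
    define \<Delta> where "\<Delta> = fst (H1 q t) + snd (H2 q t)"
    have lap: "0 \<le> fst (H1 q t - W1 q t) + snd (H2 q t - W2 q t)"
      using C21_on_min_interior[OF regW tT qR] min t by (auto simp: K_def)
    have "fst (W1 q t) + snd (W2 q t) = - \<epsilon> * W q t * (4 * \<gamma> + 4 * \<gamma>\<^sup>2 * (q \<bullet> q))"
      by (simp add: W1_def W2_def inner_prod_def power2_eq_square algebra_simps)
    then have lap': "- (\<epsilon> * W q t * (4 * \<gamma> + 4 * \<gamma>\<^sup>2 * (q \<bullet> q))) \<le> \<Delta>"
      using lap by (simp add: \<Delta>_def)
    have "q \<bullet> q \<le> R\<^sup>2" using qR by (simp add: qq power_mono)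
    then have "4 * \<gamma> + 4 * \<gamma>\<^sup>2 * (q \<bullet> q) \<le> 4 * \<gamma> + 4 * \<gamma>\<^sup>2 * R\<^sup>2" by (simp add: mult_left_mono)
    then have "\<epsilon> * W q t * (4 * \<gamma> + 4 * \<gamma>\<^sup>2 * (q \<bullet> q)) \<le> \<epsilon> * W q t * (4 * \<gamma> + 4 * \<gamma>\<^sup>2 * R\<^sup>2)"
      using \<epsilon> W[of q t] by (intro mult_left_mono) auto
    then have lap'': "- (\<epsilon> * W q t * (4 * \<gamma> + 4 * \<gamma>\<^sup>2 * R\<^sup>2)) \<le> \<Delta>" using lap' by linarith
    obtain a where a: "0 \<le> a" "a \<le> A" "a * \<Delta> + B * z q t \<le> zt q t"
      using int[OF qR tpos t(2) neg] unfolding \<Delta>_def by blast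
    define M where "M = \<epsilon> * W q t * (4 * \<gamma> + 4 * \<gamma>\<^sup>2 * R\<^sup>2)"
    have M0: "0 \<le> M" unfolding M_def using \<epsilon> W[of q t] \<gamma> by (intro mult_nonneg_nonneg) auto
    have "a * (- M) \<le> a * \<Delta>" using a lap'' by (intro mult_left_mono) (auto simp: M_def)
    moreover have "a * M \<le> \<bar>A\<bar> * M" using a M0 by (intro mult_right_mono) auto
    moreover have "\<bar>A\<bar> * M + \<bar>B\<bar> * (\<epsilon> * W q t) + \<epsilon> * W q t = \<Lambda> * (\<epsilon> * W q t)"
      by (simp add: \<Lambda>_def M_def algebra_simps)
    moreover have "B * (\<epsilon> * W q t) \<le> \<bar>B\<bar> * (\<epsilon> * W q t)" using \<epsilon> W[of q t] by (intro mult_right_mono) auto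
    moreover have "0 < \<epsilon> * W q t" using \<epsilon> W[of q t] by simp
    ultimately show False using dt a(3) zqt by (simp add: algebra_simps)
  qed
qed

section \<open>Comparison of two solutions of the normalised flow\<close>

lemma exp_diff_le:
  fixes x y M :: real
  assumes "x \<le> y" "y \<le> M"
  shows "exp y - exp x \<le> exp M * (y - x)"
proof -
  have "1 + (x - y) \<le> exp (x - y)" by (rule exp_ge_add_one_self)
  then have "exp y * (1 + (x - y)) \<le> exp y * exp (x - y)" by (intro mult_left_mono) auto
  also have "\<dots> = exp x" by (simp add: exp_diff)
  finally have "exp y - exp x \<le> exp y * (y - x)" by (simp add: algebra_simps)
  also have "\<dots> \<le> exp M * (y - x)" using assms by (intro mult_right_mono) auto
  finally show ?thesis .
qed

text \<open>Controls the remainder in the difference of two solutions: with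
  \<open>exp (- 2 * U)\<close> kept in front of the Laplacian of \<open>U - u\<close>, what is left
  is \<open>exp (- 2 * U) - exp (- 2 * u)\<close> times the Laplacian of \<open>u\<close>.\<close>

lemma exp_diff_mult_ge:
  fixes x y l M N :: real
  assumes "\<bar>x\<bar> \<le> M" "\<bar>y\<bar> \<le> M" "\<bar>l\<bar> \<le> N"
  shows "- (2 * exp (2 * M) * N * \<bar>x - y\<bar>) \<le> (exp (- 2 * x) - exp (- 2 * y)) * l"
proof -
  have "\<bar>exp (- 2 * x) - exp (- 2 * y)\<bar> \<le> exp (2 * M) * \<bar>2 * (x - y)\<bar>"
    using exp_diff_le[of "- 2 * x" "- 2 * y" "2 * M"] exp_diff_le[of "- 2 * y" "- 2 * x" "2 * M"] assms
    by (cases "x \<le> y") (auto simp: abs_le_iff abs_if[of "x - y"] abs_if[of "exp _ - exp _"])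
  then have "\<bar>exp (- 2 * x) - exp (- 2 * y)\<bar> * \<bar>l\<bar> \<le> (exp (2 * M) * \<bar>2 * (x - y)\<bar>) * N"
    using assms by (intro mult_mono) auto
  then show ?thesis by (simp add: abs_mult flip: abs_mult) (auto simp: abs_if algebra_simps split: if_splits)
qed

lemma has_real_derivative_ge:
  fixes f :: "real \<Rightarrow> real"
  assumes der: "(f has_real_derivative l) (at x within S)" and "0 < d"
    and "\<And>h. 0 < h \<Longrightarrow> h < d \<Longrightarrow> x + h \<in> S"
    and "\<And>h. 0 < h \<Longrightarrow> h < d \<Longrightarrow> c * h \<le> f (x + h) - f x"
  shows "c \<le> l"
proof (rule ccontr)
  assume "\<not> c \<le> l"
  have "((\<lambda>y. f y - c * y) has_real_derivative l - c) (at x within S)"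
    using der by (auto intro!: derivative_eq_intros)
  from has_real_derivative_neg_dec_right[OF this] \<open>\<not> c \<le> l\<close>
  obtain d' where d': "0 < d'"
    "\<And>h. 0 < h \<Longrightarrow> x + h \<in> S \<Longrightarrow> h < d' \<Longrightarrow> f (x + h) - c * (x + h) < f x - c * x"
    by auto
  define h where "h = min d d' / 2"
  have "0 < h" "h < d" "h < d'" using d' \<open>0 < d\<close> by (auto simp: h_def)
  then show False using d'(2)[of h] assms(3,4)[of h] by (auto simp: algebra_simps)
qed

lemma C21_on_bounded:
  assumes reg: "C21_on (cball 0 R) T v G H1 H2 vt" and "s1 < T"
  obtains M where "\<And>p s. norm p \<le> R \<Longrightarrow> 0 \<le> s \<Longrightarrow> s \<le> s1 \<Longrightarrow> \<bar>v p s\<bar> \<le> M"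
    and "\<And>p s. norm p \<le> R \<Longrightarrow> 0 \<le> s \<Longrightarrow> s \<le> s1 \<Longrightarrow> \<bar>fst (H1 p s) + snd (H2 p s)\<bar> \<le> M"
proof -
  define K where "K = cball (0::real \<times> real) R \<times> {0..s1}"
  have K: "compact K" "K \<subseteq> cball 0 R \<times> {0..<T}" using assms by (auto simp: K_def intro!: compact_Times)
  note cont = C21_on_continuous[OF reg, THEN continuous_on_subset, OF K(2)]
  have "compact ((\<lambda>x. v (fst x) (snd x)) ` K)"
    "compact ((\<lambda>x. fst (H1 (fst x) (snd x)) + snd (H2 (fst x) (snd x))) ` K)"
    by (intro compact_continuous_image K(1) continuous_intros cont)+
  from this[THEN compact_imp_bounded] obtain M1 M2 where
    "\<forall>x\<in>K. \<bar>v (fst x) (snd x)\<bar> \<le> M1" "\<forall>x\<in>K. \<bar>fst (H1 (fst x) (snd x)) + snd (H2 (fst x) (snd x))\<bar> \<le> M2"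
    unfolding bounded_iff by auto
  then show ?thesis using that[of "max M1 M2"] by (fastforce simp: K_def le_max_iff_disj)
qed

text \<open>The difference \<open>U - u\<close> satisfies a linear inequality with bounded
  coefficients. On the circle, where \<open>U < u\<close>, the flux difference is at least
  \<open>R * hu * (exp U - exp u)\<close> because \<open>hu \<le> hU\<close>; as \<open>hu\<close>
  lies between 0 and \<open>hmax\<close>, the Lipschitz bound for \<open>exp\<close> turns this into
  a Robin inequality.\<close>

lemma flow_comparison:
  assumes R: "0 < R" and s1: "s1 < T"
    and regU: "C21_on (cball 0 R) T U GU U1 U2 Ut"
    and regu: "C21_on (cball 0 R) T u Gu u1 u2 ut"
    and pdeU: "\<And>p s. norm p < R \<Longrightarrow> 0 < s \<Longrightarrow> s \<le> s1 \<Longrightarrow>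
      Ut p s = exp (- 2 * U p s) * (fst (U1 p s) + snd (U2 p s)) - 1"
    and pdeu: "\<And>p s. norm p < R \<Longrightarrow> 0 < s \<Longrightarrow> s \<le> s1 \<Longrightarrow>
      ut p s = exp (- 2 * u p s) * (fst (u1 p s) + snd (u2 p s)) - 1"
    and bdryU: "\<And>p s. norm p = R \<Longrightarrow> 0 < s \<Longrightarrow> s \<le> s1 \<Longrightarrow> GU p s \<bullet> p + 1 = R * hU s * exp (U p s)"
    and bdryu: "\<And>p s. norm p = R \<Longrightarrow> 0 < s \<Longrightarrow> s \<le> s1 \<Longrightarrow> Gu p s \<bullet> p + 1 = R * hu s * exp (u p s)"
    and h: "\<And>s. 0 < s \<Longrightarrow> s \<le> s1 \<Longrightarrow> 0 \<le> hu s \<and> hu s \<le> hU s \<and> hu s \<le> hmax"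
    and init: "\<And>p. norm p \<le> R \<Longrightarrow> u p 0 \<le> U p 0"
    and p: "norm p \<le> R" "0 \<le> s" "s \<le> s1"
  shows "u p s \<le> U p s"
proof -
  obtain M where M: "\<And>p s. norm p \<le> R \<Longrightarrow> 0 \<le> s \<Longrightarrow> s \<le> s1 \<Longrightarrow> \<bar>U p s\<bar> \<le> M"
    using C21_on_bounded[OF regU s1] by metis
  obtain N where N: "\<And>p s. norm p \<le> R \<Longrightarrow> 0 \<le> s \<Longrightarrow> s \<le> s1 \<Longrightarrow> \<bar>u p s\<bar> \<le> N"
    "\<And>p s. norm p \<le> R \<Longrightarrow> 0 \<le> s \<Longrightarrow> s \<le> s1 \<Longrightarrow> \<bar>fst (u1 p s) + snd (u2 p s)\<bar> \<le> N"
    using C21_on_bounded[OF regu s1] by metis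
  define m where "m = max M N"
  have "0 \<le> U p s - u p s"
  proof (rule parabolic_minimum_principle[OF R C21_on_diff[OF regU regu] s1 _ _ _ p,
        where A = "exp (2 * m)" and B = "2 * exp (2 * m) * N" and C = "R * hmax * exp m"])
    fix p s assume p: "norm p < R" and s: "0 < s" "s \<le> s1" and neg: "U p s - u p s < 0"
    have b: "\<bar>U p s\<bar> \<le> m" "\<bar>u p s\<bar> \<le> m"
      using M[of p s] N(1)[of p s] p s by (auto simp: m_def)
    have "- (2 * exp (2 * m) * N * \<bar>U p s - u p s\<bar>)
        \<le> (exp (- 2 * U p s) - exp (- 2 * u p s)) * (fst (u1 p s) + snd (u2 p s))"
      using p s by (intro exp_diff_mult_ge b N(2)) auto
    moreover have "\<bar>U p s - u p s\<bar> = - (U p s - u p s)" using neg by simp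
    ultimately have "exp (- 2 * U p s) * (fst (U1 p s - u1 p s) + snd (U2 p s - u2 p s))
        + 2 * exp (2 * m) * N * (U p s - u p s) \<le> Ut p s - ut p s"
      using pdeU[OF p s] pdeu[OF p s] by (simp add: algebra_simps)
    moreover have "exp (- 2 * U p s) \<le> exp (2 * m)" using b by auto
    ultimately show "\<exists>a. 0 \<le> a \<and> a \<le> exp (2 * m) \<and> a * (fst (U1 p s - u1 p s) + snd (U2 p s - u2 p s))
        + 2 * exp (2 * m) * N * (U p s - u p s) \<le> Ut p s - ut p s"
      by (intro exI[of _ "exp (- 2 * U p s)"]) auto
  next
    fix p s assume p: "norm p = R" and s: "0 < s" "s \<le> s1" and neg: "U p s - u p s < 0"
    have "exp (u p s) - exp (U p s) \<le> exp m * (u p s - U p s)"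
      using neg N(1)[of p s] p s by (intro exp_diff_le) (auto simp: m_def)
    moreover have "0 \<le> exp m * (u p s - U p s)" using neg by simp
    ultimately have "hu s * (exp (u p s) - exp (U p s)) \<le> hmax * (exp m * (u p s - U p s))"
      using h[OF s] neg by (intro mult_mono) auto
    moreover have "hu s * exp (U p s) \<le> hU s * exp (U p s)" using h[OF s] by (intro mult_right_mono) auto
    ultimately have "hmax * exp m * (U p s - u p s) \<le> hU s * exp (U p s) - hu s * exp (u p s)"
      unfolding right_diff_distrib mult.assoc by linarith
    from mult_left_mono[OF this, of R] have "R * (hmax * exp m * (U p s - u p s)) \<le> R * (hU s * exp (U p s) - hu s * exp (u p s))"
      using R by simp
    then show "R * hmax * exp m * (U p s - u p s) \<le> (GU p s - Gu p s) \<bullet> p"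
      using bdryU[OF p s] bdryu[OF p s] by (simp add: inner_diff_left algebra_simps)
  qed (use init in auto)
  then show ?thesis by simp
qed

text \<open>Once \<open>u \<le> U\<close> is known, \<open>U - u\<close> is a supersolution of the
  linear equation with zeroth-order loss \<open>B = 2 * exp (2 * M) * M\<close>, so it dominates any
  subsolution \<open>\<psi>\<close> with smaller initial value and smaller boundary flux.\<close>

lemma flow_barrier:
  assumes R: "0 < R" and s1: "s1 < T"
    and regU: "C21_on (cball 0 R) T U GU U1 U2 Ut"
    and regu: "C21_on (cball 0 R) T u Gu u1 u2 ut"
    and reg\<psi>: "C21_on (cball 0 R) T \<psi> G\<psi> \<psi>1 \<psi>2 \<psi>t"
    and pdeU: "\<And>p s. norm p < R \<Longrightarrow> 0 < s \<Longrightarrow> s \<le> s1 \<Longrightarrow>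
      Ut p s = exp (- 2 * U p s) * (fst (U1 p s) + snd (U2 p s)) - 1"
    and pdeu: "\<And>p s. norm p < R \<Longrightarrow> 0 < s \<Longrightarrow> s \<le> s1 \<Longrightarrow>
      ut p s = exp (- 2 * u p s) * (fst (u1 p s) + snd (u2 p s)) - 1"
    and bounds: "\<And>p s. norm p < R \<Longrightarrow> 0 < s \<Longrightarrow> s \<le> s1 \<Longrightarrow>
      \<bar>U p s\<bar> \<le> M \<and> \<bar>u p s\<bar> \<le> M \<and> \<bar>fst (u1 p s) + snd (u2 p s)\<bar> \<le> M"
    and order: "\<And>p s. norm p < R \<Longrightarrow> 0 < s \<Longrightarrow> s \<le> s1 \<Longrightarrow> u p s \<le> U p s"
    and pde\<psi>: "\<And>p s. norm p < R \<Longrightarrow> 0 < s \<Longrightarrow> s \<le> s1 \<Longrightarrow>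
      \<psi>t p s + 2 * exp (2 * M) * M * \<psi> p s \<le> exp (- 2 * U p s) * (fst (\<psi>1 p s) + snd (\<psi>2 p s))"
    and bdry: "\<And>p s. norm p = R \<Longrightarrow> 0 < s \<Longrightarrow> s \<le> s1 \<Longrightarrow> G\<psi> p s \<bullet> p \<le> (GU p s - Gu p s) \<bullet> p"
    and init: "\<And>p. norm p \<le> R \<Longrightarrow> u p 0 + \<psi> p 0 \<le> U p 0"
    and p: "norm p \<le> R" "0 \<le> s" "s \<le> s1"
  shows "u p s + \<psi> p s \<le> U p s"
proof -
  define B where "B = 2 * exp (2 * M) * M"
  have "0 \<le> U p s - u p s - \<psi> p s"
  proof (rule parabolic_minimum_principle[OF R C21_on_diff[OF C21_on_diff[OF regU regu] reg\<psi>] s1 _ _ _ p,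
        where A = "exp (2 * M)" and B = B and C = 0])
    fix p s assume p: "norm p < R" and s: "0 < s" "s \<le> s1" and neg: "U p s - u p s - \<psi> p s < 0"
    note b = bounds[OF p s]
    \<comment> \<open>The subtraction produces the coefficient \<open>- B\<close>; since the
      difference is negative here, replacing it by \<open>B\<close> only lowers the left-hand
      side.\<close>
    have "0 \<le> B" using b by (auto simp: B_def)
    then have "B * (U p s - u p s - \<psi> p s) \<le> 0" using neg by (simp add: mult_nonneg_nonpos)
    moreover have "- (B * \<bar>U p s - u p s\<bar>)
        \<le> (exp (- 2 * U p s) - exp (- 2 * u p s)) * (fst (u1 p s) + snd (u2 p s))"
      unfolding B_def using b by (intro exp_diff_mult_ge) auto
    moreover have "\<bar>U p s - u p s\<bar> = U p s - u p s" using order[OF p s] by simp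
    ultimately have "exp (- 2 * U p s) * (fst (U1 p s - u1 p s - \<psi>1 p s) + snd (U2 p s - u2 p s - \<psi>2 p s))
        + B * (U p s - u p s - \<psi> p s) \<le> Ut p s - ut p s - \<psi>t p s"
      using pdeU[OF p s] pdeu[OF p s] pde\<psi>[OF p s, folded B_def] by (simp add: algebra_simps)
    moreover have "exp (- 2 * U p s) \<le> exp (2 * M)" using b by auto
    ultimately show "\<exists>a. 0 \<le> a \<and> a \<le> exp (2 * M) \<and>
        a * (fst (U1 p s - u1 p s - \<psi>1 p s) + snd (U2 p s - u2 p s - \<psi>2 p s))
        + B * (U p s - u p s - \<psi> p s) \<le> Ut p s - ut p s - \<psi>t p s"
      by (intro exI[of _ "exp (- 2 * U p s)"]) auto
  next
    fix p :: "real \<times> real" and s assume "norm p = R" "0 < s" "s \<le> s1"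
    from bdry[OF this] show "0 * (U p s - u p s - \<psi> p s) \<le> (GU p s - Gu p s - G\<psi> p s) \<bullet> p"
      by (simp add: inner_diff_left)
  next
    fix p :: "real \<times> real" assume "norm p \<le> R"
    from init[OF this] show "0 \<le> U p 0 - u p 0 - \<psi> p 0" by simp
  qed
  then show ?thesis by simp
qed

subsection \<open>Solutions starting at a stationary metric\<close>

text \<open>\<open>pde\<close> says u_s = -K - 1 for the metric exp(2u)|dx|^2, so
  \<open>static\<close> means K = -1 at time 0. \<open>bdry\<close> is the equation for the geodesic
  curvature \<open>h\<close>, multiplied by \<open>R * exp u\<close>.\<close>

locale flow_from_static =
  fixes R T :: real and u ut :: "real \<times> real \<Rightarrow> real \<Rightarrow> real"
    and G H1 H2 :: "real \<times> real \<Rightarrow> real \<Rightarrow> real \<times> real" and h :: "real \<Rightarrow> real"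
  assumes R: "0 < R" and reg: "C21_on (cball 0 R) T u G H1 H2 ut"
    and pde: "\<And>p s. norm p < R \<Longrightarrow> 0 \<le> s \<Longrightarrow> s < T \<Longrightarrow>
      ut p s = exp (- 2 * u p s) * (fst (H1 p s) + snd (H2 p s)) - 1"
    and bdry: "\<And>p s. norm p = R \<Longrightarrow> 0 \<le> s \<Longrightarrow> s < T \<Longrightarrow> G p s \<bullet> p + 1 = R * h s * exp (u p s)"
    and static: "\<And>p. norm p < R \<Longrightarrow> ut p 0 = 0"
    and h_nonneg: "0 \<le> h 0"
    and h_mono: "\<And>x y. 0 \<le> x \<Longrightarrow> x \<le> y \<Longrightarrow> y < T \<Longrightarrow> h x \<le> h y"
begin

text \<open>The metric frozen at time 0 solves the same flow with constant boundary curvature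
  \<open>h 0\<close>, which never exceeds \<open>h\<close>.\<close>

lemma initial_le:
  assumes "norm p \<le> R" "0 \<le> s" "s < T"
  shows "u p 0 \<le> u p s"
proof (rule flow_comparison[OF R assms(3) reg C21_on_static[OF reg], where hmax = "h 0"
      and hU = h and hu = "\<lambda>_. h 0"])
  fix p :: "real \<times> real" and t :: real assume "norm p < R" "0 < t" "t \<le> s"
  then show "0 = exp (- 2 * u p 0) * (fst (H1 p 0) + snd (H2 p 0)) - 1"
    using pde[of p 0] static[of p] assms by simp
qed (use assms pde bdry h_nonneg h_mono in auto)

lemma time_mono:
  assumes "norm p \<le> R" "0 \<le> s" "0 \<le> \<delta>" "s + \<delta> < T"
  shows "u p s \<le> u p (s + \<delta>)"
\<comment> \<open>Translation by 0 merely restricts \<open>u\<close> to the interval [0, T -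
  \<delta>) on which its translate is defined.\<close>
proof (rule flow_comparison[OF R _ C21_on_shift[OF reg] C21_on_shift[OF reg, where a = 0, simplified],
      where T = "T - \<delta>" and ?s1.0 = s and hmax = "h s" and hU = "\<lambda>s. h (s + \<delta>)" and hu = h])
  fix t assume t: "0 < t" "t \<le> s"
  have "0 \<le> h t" using h_nonneg h_mono[of 0 t] t assms by simp
  then show "0 \<le> h t \<and> h t \<le> h (t + \<delta>) \<and> h t \<le> h s"
    using h_mono t assms by simp
next
  fix p :: "real \<times> real" assume "norm p \<le> R"
  then show "u p 0 \<le> u p (0 + \<delta>)" using initial_le assms by simp
qed (use assms pde bdry in auto)

lemma time_derivative_nonneg:
  assumes p: "norm p \<le> R" and s: "0 \<le> s" "s < T"
  shows "0 \<le> ut p s"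
proof (rule has_real_derivative_ge[OF C21_onD(4)[OF reg], where d = "T - s"])
  fix \<delta> assume "0 < \<delta>" "\<delta> < T - s"
  then show "0 * \<delta> \<le> u p (s + \<delta>) - u p s" using time_mono[OF p s(1)] by simp
qed (use assms in auto)

text \<open>Boundary growth between \<open>a\<close> and \<open>a + 2 * e\<close> lifts
  \<open>u (t + \<delta>) - u t\<close> to at least \<open>\<kappa> * \<delta>\<close> on the closed
  disk by time \<open>a + e\<close>; up to time \<open>s\<close> it loses at most the exponential
  factor in \<open>K\<close>. Neither constant depends on \<open>\<delta>\<close>.\<close>

lemma time_derivative_pos:
  assumes p: "norm p \<le> R" and s: "0 < s" "s < T"
    and e: "0 < a" "0 < e" "a + 2 * e < s"
    and c: "0 < c" "\<And>x y. a \<le> x \<Longrightarrow> x \<le> y \<Longrightarrow> y \<le> a + 2 * e \<Longrightarrow> c * (y - x) \<le> h y - h x"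
  shows "0 < ut p s"
proof -
  \<comment> \<open>Every time \<open>s + \<delta>\<close> in use stays below \<open>S < T\<close>,
    so one bound \<open>M\<close> serves all \<open>\<delta>\<close>.\<close>
  define S where "S = (s + T) / 2"
  have S: "s < S" "S < T" using s by (auto simp: S_def)
  obtain M where M: "\<And>p t. norm p \<le> R \<Longrightarrow> 0 \<le> t \<Longrightarrow> t \<le> S \<Longrightarrow> \<bar>u p t\<bar> \<le> M"
    "\<And>p t. norm p \<le> R \<Longrightarrow> 0 \<le> t \<Longrightarrow> t \<le> S \<Longrightarrow> \<bar>fst (H1 p t) + snd (H2 p t)\<bar> \<le> M"
    using C21_on_bounded[OF reg S(2)] by blast
  have "\<bar>u 0 0\<bar> \<le> M" using M(1)[of 0 0] R s S by simp
  then have M0: "0 \<le> M" by linarith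
  define B where "B = 2 * exp (2 * M) * M"
  have B0: "0 \<le> B" using M0 by (simp add: B_def)
  \<comment> \<open>On the disk the exponent \<open>L * (V * t + fst p)\<close> is at most
    \<open>L * R\<close> at time 0 and at least \<open>2 * L * R\<close> at time
    \<open>e\<close>.\<close>
  define V where "V = 3 * R / e"
  have V: "0 < V" "V * e = 3 * R" using R e by (auto simp: V_def)
  \<comment> \<open>Large enough for \<open>L2\<close>: the diffusion \<open>L^2\<close>, with
    coefficient at least \<open>exp (- 2 * M)\<close>, absorbs the time derivative
    \<open>L * V\<close> and the loss \<open>B\<close>.\<close>
  define L where "L = exp (2 * M) * (V + B) + 1"
  have L: "1 \<le> L" using V B0 by (simp add: L_def)
  have L2: "L * V + B \<le> exp (- 2 * M) * L\<^sup>2"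
  proof -
    have "V + B \<le> exp (- 2 * M) * L"
      by (simp add: L_def exp_minus field_simps)
    then have "L * (V + B) \<le> L * (exp (- 2 * M) * L)" using L by (intro mult_left_mono) auto
    moreover have "1 * B \<le> L * B" using L B0 by (intro mult_right_mono) auto
    ultimately show ?thesis by (simp add: power2_eq_square algebra_simps)
  qed
  \<comment> \<open>On the circle \<open>V * t + fst p \<le> 4 * R\<close>, so the flux of the wave
    of amplitude \<open>\<epsilon> * \<delta>\<close> is at most
    \<open>\<epsilon> * \<delta> * Q * R\<close>; \<open>\<epsilon>\<close> makes this equal to the
    guaranteed flux \<open>R * c * \<delta> * exp (- M)\<close>.\<close>
  define Q where "Q = L * exp (L * (4 * R))"
  have Q: "0 < Q" using L by (simp add: Q_def)
  define \<epsilon> where "\<epsilon> = c * exp (- M) / Q"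
  have \<epsilon>: "0 < \<epsilon>" using c Q by (simp add: \<epsilon>_def)
  \<comment> \<open>Subtracting the largest initial value of the wave makes the barrier start
    nonpositive; this is what remains of it at time \<open>e\<close>, per unit of
    \<open>\<delta>\<close>.\<close>
  define \<kappa> where "\<kappa> = \<epsilon> * (exp (2 * L * R) - exp (L * R))"
  have \<kappa>: "0 < \<kappa>" using \<epsilon> L R by (simp add: \<kappa>_def)
  define K where "K = \<kappa> * exp (- B * (s - (a + e)))"
  have x_le: "\<bar>fst q\<bar> \<le> R" if "norm q \<le> R" for q :: "real \<times> real"
    using that norm_fst_le[of "fst q" "snd q"] by simp
  \<comment> \<open>Both \<open>h\<close> and \<open>exp u\<close> increase in time; only the
    increase of \<open>h\<close> is kept, weighted by \<open>exp u \<ge> exp (- M)\<close>.\<close>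
  have flux: "R * ((h (t + \<delta>) - h t) * exp (- M)) \<le> (G q (t + \<delta>) - G q t) \<bullet> q"
    if q: "norm q = R" and t: "0 \<le> t" "0 \<le> \<delta>" "t + \<delta> \<le> S" for q t \<delta>
  proof -
    have hh: "0 \<le> h t" "h t \<le> h (t + \<delta>)"
      using h_nonneg h_mono[of 0 t] h_mono[of t "t + \<delta>"] t S by auto
    have "exp (u q t) \<le> exp (u q (t + \<delta>))" using time_mono[of q t \<delta>] q t S by simp
    then have "h t * exp (u q t) \<le> h t * exp (u q (t + \<delta>))" using hh by (intro mult_left_mono) auto
    moreover have "- M \<le> u q (t + \<delta>)" using M(1)[of q "t + \<delta>"] q t by simp
    then have "(h (t + \<delta>) - h t) * exp (- M) \<le> (h (t + \<delta>) - h t) * exp (u q (t + \<delta>))"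
      using hh by (intro mult_left_mono) auto
    ultimately have "(h (t + \<delta>) - h t) * exp (- M) \<le> h (t + \<delta>) * exp (u q (t + \<delta>)) - h t * exp (u q t)"
      by (simp add: algebra_simps)
    from mult_left_mono[OF this, of R] show ?thesis
      using bdry[of q t] bdry[of q "t + \<delta>"] q t S R by (simp add: inner_diff_left algebra_simps)
  qed
  have first: "u q (a + e) + \<kappa> * \<delta> \<le> u q (a + e + \<delta>)"
    if q: "norm q \<le> R" and \<delta>: "0 < \<delta>" "\<delta> < e" "s + \<delta> \<le> S" for q \<delta>
  proof -
    \<comment> \<open>A plane wave of speed V crosses the disk within time e; the boundary growth of h pays for
      its outward flux.\<close>
    define E where "E p t = \<epsilon> * \<delta> * exp (L * V * t + L * fst p + 0 * (p \<bullet> p))"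
      for p :: "real \<times> real" and t
    define b where "b = - \<epsilon> * \<delta> * exp (L * R)"
    have E: "0 < E p t" for p t using \<epsilon> \<delta> by (simp add: E_def)
    have b: "b \<le> 0" using \<epsilon> \<delta> by (simp add: b_def)
    have "u q (e + a) + (E q e + b) \<le> u q (e + (a + \<delta>))"
    proof (rule flow_barrier[OF R _ C21_on_shift[OF reg] C21_on_shift[OF reg]
          C21_on_exp[where \<kappa> = "\<epsilon> * \<delta>" and \<alpha> = "L * V" and \<beta> = L and \<gamma> = 0 and d = b, folded E_def],
          where T = "T - a - \<delta>" and ?s1.0 = e and M = M])
      fix p :: "real \<times> real" and t assume p: "norm p < R" and t: "0 < t" "t \<le> e"
      show "\<bar>u p (t + (a + \<delta>))\<bar> \<le> M \<and> \<bar>u p (t + a)\<bar> \<le> M \<and>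
          \<bar>fst (H1 p (t + a)) + snd (H2 p (t + a))\<bar> \<le> M"
        using M p t e \<delta> S by simp
      show "u p (t + a) \<le> u p (t + (a + \<delta>))"
        using time_mono[of p "t + a" \<delta>] p t e \<delta> S by (simp add: add.assoc)
      have "- 2 * M \<le> - 2 * u p (t + (a + \<delta>))" using M(1)[of p "t + (a + \<delta>)"] p t e \<delta> by simp
      then have "exp (- 2 * M) * L\<^sup>2 \<le> exp (- 2 * u p (t + (a + \<delta>))) * L\<^sup>2" by (intro mult_right_mono) auto
      then have "(L * V + B) * E p t \<le> (exp (- 2 * u p (t + (a + \<delta>))) * L\<^sup>2) * E p t"
        using L2 E[of p t] by (intro mult_right_mono) auto
      moreover have "B * b \<le> 0" using B0 b by (simp add: mult_nonneg_nonpos)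
      ultimately show "L * V * E p t + 2 * exp (2 * M) * M * (E p t + b) \<le> exp (- 2 * u p (t + (a + \<delta>))) *
          (fst (E p t *\<^sub>R ((L + 2 * 0 * fst p)\<^sup>2 + 2 * 0, (L + 2 * 0 * fst p) * (2 * 0 * snd p))) +
           snd (E p t *\<^sub>R ((L + 2 * 0 * fst p) * (2 * 0 * snd p), (2 * 0 * snd p)\<^sup>2 + 2 * 0)))"
        unfolding B_def[symmetric] by (simp add: algebra_simps)
    next
      fix p :: "real \<times> real" and t assume p: "norm p = R" and t: "0 < t" "t \<le> e"
      have "V * t \<le> 3 * R" using t V by (metis less_imp_le mult_left_mono)
      then have "L * (V * t + fst p) \<le> L * (4 * R)" using x_le[of p] p L by (intro mult_left_mono) auto
      then have "E p t \<le> \<epsilon> * \<delta> * exp (L * (4 * R))"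
        using \<epsilon> \<delta> unfolding E_def by (intro mult_left_mono) (auto simp: algebra_simps)
      then have "E p t * (L * fst p) \<le> (\<epsilon> * \<delta> * exp (L * (4 * R))) * (L * R)"
        using x_le[of p] p L E[of p t] R
        by (intro order_trans[OF mult_left_mono mult_right_mono]) auto
      also have "\<dots> = R * (c * \<delta> * exp (- M))" using L by (simp add: \<epsilon>_def Q_def)
      \<comment> \<open>The growth window has length \<open>2 * e\<close> because
        \<open>t \<le> e\<close> and \<open>\<delta> < e\<close>.\<close>
      also have "\<dots> \<le> R * ((h (t + (a + \<delta>)) - h (t + a)) * exp (- M))"
        using c(2)[of "t + a" "t + (a + \<delta>)"] t e \<delta> R by (intro mult_left_mono mult_right_mono) auto
      also have "\<dots> \<le> (G p (t + (a + \<delta>)) - G p (t + a)) \<bullet> p"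
        using flux[of p "t + a" \<delta>] p t e \<delta> by (simp add: add.assoc)
      finally show "(E p t *\<^sub>R (L + 2 * 0 * fst p, 2 * 0 * snd p)) \<bullet> p
          \<le> (G p (t + (a + \<delta>)) - G p (t + a)) \<bullet> p"
        by (simp add: inner_prod_def mult.assoc)
    next
      fix p :: "real \<times> real" assume p: "norm p \<le> R"
      have "exp (L * fst p) \<le> exp (L * R)" using x_le[OF p] L by simp
      from mult_left_mono[OF this, of "\<epsilon> * \<delta>"] have "E p 0 + b \<le> 0"
        using \<epsilon> \<delta> by (simp add: E_def b_def)
      then show "u p (0 + a) + (E p 0 + b) \<le> u p (0 + (a + \<delta>))"
        using time_mono[of p a \<delta>] p e \<delta> S by simp
    qed (use e \<delta> S q pde in auto)
    moreover have "\<kappa> * \<delta> \<le> E q e + b"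
    proof -
      have "2 * L * R \<le> L * V * e + L * fst q"
        using mult_left_mono[of "2 * R" "V * e + fst q" L] x_le[OF q] V L by (simp add: algebra_simps)
      then have "\<epsilon> * \<delta> * exp (2 * L * R) \<le> E q e" using \<epsilon> \<delta> by (simp add: E_def)
      then show ?thesis by (simp add: \<kappa>_def b_def algebra_simps)
    qed
    ultimately show ?thesis by (simp add: algebra_simps)
  qed
  have second: "u p s + K * \<delta> \<le> u p (s + \<delta>)" if \<delta>: "0 < \<delta>" "\<delta> < e" "s + \<delta> \<le> S" for \<delta>
  proof -
    \<comment> \<open>After time \<open>a + e\<close> only monotonicity of \<open>h\<close> is
      available, so the barrier has no flux: constant in space, decaying at the loss rate
      \<open>B\<close>.\<close>
    define E where "E p t = \<kappa> * \<delta> * exp (- B * t + 0 * fst p + 0 * (p \<bullet> p))"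
      for p :: "real \<times> real" and t
    have "u p ((s - (a + e)) + (a + e)) + (E p (s - (a + e)) + 0) \<le> u p ((s - (a + e)) + (a + e + \<delta>))"
    proof (rule flow_barrier[OF R _ C21_on_shift[OF reg] C21_on_shift[OF reg]
          C21_on_exp[where \<kappa> = "\<kappa> * \<delta>" and \<alpha> = "- B" and \<beta> = 0 and \<gamma> = 0 and d = 0, folded E_def],
          where T = "T - (a + e) - \<delta>" and ?s1.0 = "s - (a + e)" and M = M])
      fix q :: "real \<times> real" and t assume q: "norm q < R" and t: "0 < t" "t \<le> s - (a + e)"
      show "\<bar>u q (t + (a + e + \<delta>))\<bar> \<le> M \<and> \<bar>u q (t + (a + e))\<bar> \<le> M \<and>
          \<bar>fst (H1 q (t + (a + e))) + snd (H2 q (t + (a + e)))\<bar> \<le> M"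
        using M q t e \<delta> S by simp
      show "u q (t + (a + e)) \<le> u q (t + (a + e + \<delta>))"
        using time_mono[of q "t + (a + e)" \<delta>] q t e \<delta> S by (simp add: add.assoc)
    next
      fix q :: "real \<times> real" and t assume q: "norm q = R" and t: "0 < t" "t \<le> s - (a + e)"
      have "h (t + (a + e)) \<le> h (t + (a + e) + \<delta>)" using h_mono t e \<delta> S by simp
      then have "0 \<le> R * ((h (t + (a + e) + \<delta>) - h (t + (a + e))) * exp (- M))" using R by simp
      also have "\<dots> \<le> (G q (t + (a + e) + \<delta>) - G q (t + (a + e))) \<bullet> q"
        using flux[of q "t + (a + e)" \<delta>] q t e \<delta> by simp
      finally show "(E q t *\<^sub>R (0 + 2 * 0 * fst q, 2 * 0 * snd q)) \<bullet> q
          \<le> (G q (t + (a + e + \<delta>)) - G q (t + (a + e))) \<bullet> q"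
        by (simp add: inner_prod_def add.assoc)
    next
      fix q :: "real \<times> real" assume "norm q \<le> R"
      from first[OF this \<delta>] show "u q (0 + (a + e)) + (E q 0 + 0) \<le> u q (0 + (a + e + \<delta>))"
        by (simp add: E_def)
    qed (use e \<delta> S p pde in \<open>auto simp: B_def\<close>)
    then show ?thesis by (simp add: E_def K_def algebra_simps)
  qed
  have "K \<le> ut p s"
  proof (rule has_real_derivative_ge[OF C21_onD(4)[OF reg], where d = "min e (S - s)"])
    fix \<delta> assume "0 < \<delta>" "\<delta> < min e (S - s)"
    then show "K * \<delta> \<le> u p (s + \<delta>) - u p s" using second[of \<delta>] by simp
  qed (use e S s p in auto)
  moreover have "0 < K" using \<kappa> by (simp add: K_def)
  ultimately show ?thesis by simp
qed

end

subsection \<open>Reduction to the stationary case\<close>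

lemma mvt_within:
  fixes f :: "real \<Rightarrow> real"
  assumes der: "\<And>t. a \<le> t \<Longrightarrow> t \<le> b \<Longrightarrow> (f has_real_derivative f' t) (at t within S)"
    and sub: "{a..b} \<subseteq> S" and "a < b"
  obtains x where "a < x" "x < b" "f b - f a = f' x * (b - a)"
proof -
  have "\<exists>x\<in>{a<..<b}. f b - f a = f' x * (b - a)"
  proof (rule mvt_simple[OF \<open>a < b\<close>])
    fix x assume "a \<le> x" "x \<le> b"
    from has_field_derivative_subset[OF der[OF this] sub]
    show "(f has_derivative (\<lambda>y. f' x * y)) (at x within {a..b})"
      by (simp add: has_field_derivative_def)
  qed
  then show ?thesis using that by auto
qed

lemma growth_of_derivative_ge:
  fixes f :: "real \<Rightarrow> real"
  assumes der: "\<And>t. a \<le> t \<Longrightarrow> t \<le> b \<Longrightarrow> (f has_real_derivative f' t) (at t within S)"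
    and sub: "{a..b} \<subseteq> S" and ge: "\<And>t. a \<le> t \<Longrightarrow> t \<le> b \<Longrightarrow> c \<le> f' t" and "a \<le> b"
  shows "c * (b - a) \<le> f b - f a"
proof (cases "a = b")
  case False
  then have "a < b" using \<open>a \<le> b\<close> by simp
  then obtain x where "a < x" "x < b" "f b - f a = f' x * (b - a)"
    using mvt_within[OF der sub] by blast
  then show ?thesis using ge[of x] \<open>a < b\<close> by (auto intro!: mult_right_mono)
qed simp

text \<open>Liouville's equation: ln(2/(1 - |p|^2)) has Laplacian 4/(1 - |p|^2)^2, and the factor
  \<open>m\<close> only adds a constant to \<open>v\<close>. As \<open>G\<close>, \<open>H1\<close>,
  \<open>H2\<close> are given merely as derivatives, uniqueness of derivatives on the open disk
  identifies them with the explicit ones.\<close>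

lemma hyp_factor_laplacian:
  assumes reg: "C21_on (cball 0 R) T v G H1 H2 vt" and "0 < T" and R1: "R \<le> 1"
    and init: "\<And>q. norm q < R \<Longrightarrow> exp (2 * v q 0) = m * hyp_factor q" and "0 < m"
    and p: "norm p < R"
  shows "fst (H1 p 0) + snd (H2 p 0) = hyp_factor p"
proof -
  define N where "N q = 1 - (fst q * fst q + snd q * snd q)" for q :: "real \<times> real"
  have N_norm: "N q = 1 - (norm q)\<^sup>2" for q
    by (simp add: N_def power2_norm_eq_inner inner_prod_def)
  have N: "0 < N q" if "norm q < R" for q
  proof -
    have "(norm q)\<^sup>2 < 1" using that R1 by (simp add: power_less_one_iff)
    then show ?thesis by (simp add: N_norm)
  qed
  have v: "v q 0 = ln m / 2 + ln 2 - ln (N q)" if q: "norm q < R" for q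
  proof -
    have "2 * v q 0 = ln (m * (4 / (N q)\<^sup>2))"
      using init[OF q] by (metis N_norm hyp_factor_def ln_exp)
    also have "\<dots> = ln m + 2 * ln 2 - 2 * ln (N q)"
      using N[OF q] \<open>0 < m\<close> ln_realpow[of "2::real" 2] by (simp add: ln_mult ln_div ln_realpow)
    finally show ?thesis by simp
  qed
  have at: "at q within cball 0 R = at q" if "norm q < R" for q :: "real \<times> real"
    using at_within_interior[of q "cball 0 R"] that by (simp add: interior_cball)
  have D: "((\<lambda>q. v q 0) has_derivative (\<lambda>h. G q 0 \<bullet> h)) (at q)"
    "((\<lambda>q. fst (G q 0)) has_derivative (\<lambda>h. H1 q 0 \<bullet> h)) (at q)"
    "((\<lambda>q. snd (G q 0)) has_derivative (\<lambda>h. H2 q 0 \<bullet> h)) (at q)" if "norm q < R" for q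
    using C21_onD[OF reg, of q 0] at[OF that] that \<open>0 < T\<close> by simp_all
  have open_R: "open {q :: real \<times> real. norm q < R}" by (intro open_Collect_less continuous_intros)
  have G: "fst (G q 0) = 2 * fst q / N q" "snd (G q 0) = 2 * snd q / N q" if q: "norm q < R" for q
  proof -
    have "((\<lambda>q. ln m / 2 + ln 2 - ln (N q)) has_derivative
        (\<lambda>h. (2 * fst q * fst h + 2 * snd q * snd h) / N q)) (at q)"
      using N[OF q] unfolding N_def
      by (auto intro!: derivative_eq_intros simp: fun_eq_iff field_simps)
    then have "((\<lambda>q. v q 0) has_derivative
        (\<lambda>h. (2 * fst q * fst h + 2 * snd q * snd h) / N q)) (at q)"
      by (rule has_derivative_transform_within_open[OF _ open_R]) (use q v in auto)
    from has_derivative_unique[OF this D(1)[OF q]]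
    have eq: "(2 * fst q * fst h + 2 * snd q * snd h) / N q = G q 0 \<bullet> h" for h by metis
    show "fst (G q 0) = 2 * fst q / N q" "snd (G q 0) = 2 * snd q / N q"
      using eq[of "(1, 0)"] eq[of "(0, 1)"] by (simp_all add: inner_prod_def)
  qed
  note Np = N[OF p]
  have d1: "((\<lambda>q. fst (G q 0)) has_derivative (\<lambda>h. 2 * fst h / N p +
      2 * fst p * (2 * fst p * fst h + 2 * snd p * snd h) / (N p)\<^sup>2)) (at p)"
  proof (rule has_derivative_transform_within_open[OF _ open_R])
    show "((\<lambda>q. 2 * fst q / N q) has_derivative (\<lambda>h. 2 * fst h / N p +
      2 * fst p * (2 * fst p * fst h + 2 * snd p * snd h) / (N p)\<^sup>2)) (at p)"
      using Np unfolding N_def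
      by (auto intro!: derivative_eq_intros simp: fun_eq_iff power2_eq_square divide_simps)
         (simp add: algebra_simps)
  qed (use p G in auto)
  have d2: "((\<lambda>q. snd (G q 0)) has_derivative (\<lambda>h. 2 * snd h / N p +
      2 * snd p * (2 * fst p * fst h + 2 * snd p * snd h) / (N p)\<^sup>2)) (at p)"
  proof (rule has_derivative_transform_within_open[OF _ open_R])
    show "((\<lambda>q. 2 * snd q / N q) has_derivative (\<lambda>h. 2 * snd h / N p +
      2 * snd p * (2 * fst p * fst h + 2 * snd p * snd h) / (N p)\<^sup>2)) (at p)"
      using Np unfolding N_def
      by (auto intro!: derivative_eq_intros simp: fun_eq_iff power2_eq_square divide_simps)
         (simp add: algebra_simps)
  qed (use p G in auto)
  have "fst (H1 p 0) = 2 / N p + 4 * (fst p)\<^sup>2 / (N p)\<^sup>2"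
    using fun_cong[OF has_derivative_unique[OF D(2)[OF p] d1], of "(1, 0)"]
    by (simp add: inner_prod_def power2_eq_square)
  moreover have "snd (H2 p 0) = 2 / N p + 4 * (snd p)\<^sup>2 / (N p)\<^sup>2"
    using fun_cong[OF has_derivative_unique[OF D(3)[OF p] d2], of "(0, 1)"]
    by (simp add: inner_prod_def power2_eq_square)
  ultimately have "fst (H1 p 0) + snd (H2 p 0) = (4 * N p + 4 * ((fst p)\<^sup>2 + (snd p)\<^sup>2)) / (N p)\<^sup>2"
    using Np by (simp add: field_simps power2_eq_square)
  also have "\<dots> = 4 / (N p)\<^sup>2" by (simp add: N_def power2_eq_square)
  finally show ?thesis by (simp add: hyp_factor_def N_norm)
qed

section \<open>Rescaled time and boundary data\<close>

text \<open>Under t = flow_time m s one has xi m t = flow_xi m s and dt/ds = flow_xi m s, so that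
  g / xi, as a function of s, again solves the normalised flow and starts at the hyperbolic metric.\<close>

definition flow_den :: "real \<Rightarrow> real \<Rightarrow> real" where
  "flow_den m s = m * exp (2 * s) - m + 1"

text \<open>The equation dt/ds = xi(t) makes exp(2t) + m - 1 grow at rate 2 from the value m, so
  exp(2t) = \<open>flow_den m s\<close>.\<close>

definition flow_time :: "real \<Rightarrow> real \<Rightarrow> real" where
  "flow_time m s = ln (flow_den m s) / 2"

definition flow_xi :: "real \<Rightarrow> real \<Rightarrow> real" where
  "flow_xi m s = m * exp (2 * s) / flow_den m s"

lemma flow_den_ge_1:
  fixes m s :: real
  assumes "0 < m" "0 \<le> s"
  shows "1 \<le> flow_den m s"
  using mult_left_mono[of 1 "exp (2 * s)" m] assms by (simp add: flow_den_def)

lemma flow_den_pos: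
  fixes m s :: real
  assumes "0 < m" "0 \<le> s"
  shows "0 < flow_den m s"
  using flow_den_ge_1[OF assms] by simp

lemma flow_xi_pos:
  assumes "0 < m" "0 \<le> s"
  shows "0 < flow_xi m s"
  using flow_den_pos[OF assms] assms by (simp add: flow_xi_def)

lemma flow_time_0 [simp]: "flow_time m 0 = 0"
  by (simp add: flow_time_def flow_den_def)

lemma flow_time_nonneg:
  assumes "0 < m" "0 \<le> s"
  shows "0 \<le> flow_time m s"
  using flow_den_ge_1[OF assms] by (simp add: flow_time_def)

lemma xi_flow_time:
  assumes "0 < m" "0 \<le> s"
  shows "xi m (flow_time m s) = flow_xi m s"
proof -
  note pos = flow_den_pos[OF assms]
  have "exp (- 2 * flow_time m s) = inverse (flow_den m s)"
    using pos by (simp add: flow_time_def exp_minus)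
  then have "xi m (flow_time m s) = (flow_den m s + (m - 1)) / flow_den m s"
    using pos by (simp add: xi_def field_simps)
  then show ?thesis by (simp add: flow_xi_def flow_den_def)
qed

lemma ln_flow_xi:
  assumes "0 < m" "0 \<le> s"
  shows "ln (flow_xi m s) = ln m + 2 * s - 2 * flow_time m s"
  using flow_den_pos[OF assms] assms by (simp add: flow_xi_def flow_time_def ln_div ln_mult)

lemma has_derivative_flow_den:
  "(flow_den m has_real_derivative 2 * m * exp (2 * s)) (at s within S)"
  unfolding flow_den_def by (auto intro!: derivative_eq_intros)

lemma has_derivative_flow_time:
  assumes "0 < m" "0 \<le> s"
  shows "(flow_time m has_real_derivative flow_xi m s) (at s within S)"
  using flow_den_pos[OF assms] unfolding flow_time_def flow_xi_def
  by (auto intro!: derivative_eq_intros has_derivative_flow_den)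

lemma has_derivative_flow_xi:
  assumes "0 < m" "0 \<le> s"
  shows "(flow_xi m has_real_derivative - 2 * (flow_xi m s - 1) * flow_xi m s) (at s within S)"
  using flow_den_pos[OF assms] unfolding flow_xi_def
  by (auto intro!: derivative_eq_intros has_derivative_flow_den simp: field_simps power2_eq_square)

lemma continuous_on_flow_xi:
  assumes "0 < m" "S \<subseteq> {0..}"
  shows "continuous_on S (flow_xi m)"
  using has_derivative_flow_xi[OF assms(1)] assms(2)
  by (intro DERIV_continuous_on[of S _ "\<lambda>s. - 2 * (flow_xi m s - 1) * flow_xi m s"]) auto

lemma flow_time_surj:
  assumes "0 < m" "0 \<le> t"
  obtains s where "0 \<le> s" "flow_time m s = t" "0 < t \<Longrightarrow> 0 < s"
proof -
  define s where "s = ln ((exp (2 * t) + m - 1) / m) / 2"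
  have "1 \<le> exp (2 * t)" using assms by simp
  then have pos: "1 \<le> (exp (2 * t) + m - 1) / m" using assms by simp
  then have "exp (2 * s) = (exp (2 * t) + m - 1) / m" using less_le_trans[OF zero_less_one pos] by (simp add: s_def)
  then have "flow_time m s = t" using assms by (simp add: flow_time_def flow_den_def)
  moreover have "0 \<le> s" using ln_ge_zero[OF pos] by (simp add: s_def)
  ultimately show ?thesis using that[of s] by (cases "s = 0") auto
qed

lemma flow_time_less_iff:
  assumes "0 < m" "0 \<le> s" "0 \<le> s'"
  shows "flow_time m s < flow_time m s' \<longleftrightarrow> s < s'"
  using flow_den_pos[OF assms(1,2)] flow_den_pos[OF assms(1,3)] assms(1)
  by (simp add: flow_time_def) (simp add: flow_den_def)

text \<open>With \<open>c0\<close> = coth r0, \<open>h\<close> is sqrt(xi) times \<open>eta\<close>,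
  the boundary curvature of g/xi. By the equations for \<open>flow_time\<close> and
  \<open>flow_xi\<close> its derivative is a positive multiple of
  \<open>\<rho>' - (1 - 1 / xi) * \<rho>\<close>. The second claim supplies growth windows before
  any given positive time.\<close>

lemma monotone_boundary_data:
  fixes \<rho> \<rho>' :: "real \<Rightarrow> real" and m c0 :: real
  assumes m: "0 < m"
    and d\<rho>: "\<And>t. 0 \<le> t \<Longrightarrow> (\<rho> has_real_derivative \<rho>' t) (at t within {0..})"
    and cont: "continuous_on {0..} \<rho>'"
    and \<rho>0: "\<rho> 0 = 0" and mono: "\<And>t. 0 \<le> t \<Longrightarrow> 0 \<le> \<rho>' t"
    and pos: "\<And>t. 0 < t \<Longrightarrow> t < t1 \<Longrightarrow> 0 < \<rho>' t" "0 < t1"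
    and big: "\<And>t. 1 < m \<Longrightarrow> 0 \<le> t \<Longrightarrow> (1 - 1 / xi m t) * \<rho> t \<le> \<rho>' t"
  defines "h \<equiv> \<lambda>s. c0 + sqrt (flow_xi m s) * \<rho> (flow_time m s)"
  shows "0 \<le> x \<Longrightarrow> x \<le> y \<Longrightarrow> h x \<le> h y"
    and "0 < s \<Longrightarrow> \<exists>a e c. 0 < a \<and> 0 < e \<and> a + 2 * e < s \<and> 0 < c \<and>
      (\<forall>x y. a \<le> x \<longrightarrow> x \<le> y \<longrightarrow> y \<le> a + 2 * e \<longrightarrow> c * (y - x) \<le> h y - h x)"
proof -
  have \<rho>_mono: "0 \<le> \<rho> t" if "0 \<le> t" for t
    using growth_of_derivative_ge[of 0 t \<rho> \<rho>' "{0..}" 0] d\<rho> mono \<rho>0 that by auto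
  define X \<theta> where "X = flow_xi m" and "\<theta> = flow_time m"
  have X: "0 < X s" if "0 \<le> s" for s using flow_xi_pos[OF m that] by (simp add: X_def)
  have \<theta>: "0 \<le> \<theta> s" if "0 \<le> s" for s using flow_time_nonneg[OF m that] by (simp add: \<theta>_def)
  define h' where "h' s = sqrt (X s) * X s * (\<rho>' (\<theta> s) - (1 - 1 / X s) * \<rho> (\<theta> s))" for s
  have dh: "(h has_real_derivative h' s) (at s within {0..})" if s: "0 \<le> s" for s
  proof -
    have "(\<rho> has_real_derivative \<rho>' (\<theta> s)) (at (\<theta> s) within \<theta> ` {0..})"
      using d\<rho>[OF \<theta>[OF s]] by (rule has_field_derivative_subset) (use \<theta> in auto)
    from DERIV_image_chain[OF this has_derivative_flow_time[OF m s, of "{0..}", folded X_def \<theta>_def]]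
    have 1: "((\<lambda>s. \<rho> (\<theta> s)) has_real_derivative \<rho>' (\<theta> s) * X s) (at s within {0..})"
      unfolding comp_def .
    have 2: "((\<lambda>s. sqrt (X s)) has_real_derivative - 2 * (X s - 1) * X s * (inverse (sqrt (X s)) / 2)) (at s within {0..})"
      using X[OF s] has_derivative_flow_xi[OF m s, of "{0..}", folded X_def]
      by (auto intro!: derivative_eq_intros)
    have r: "X s * inverse (sqrt (X s)) = sqrt (X s)"
      using X[OF s] by (metis less_imp_le divide_inverse real_div_sqrt)
    have "- 2 * (X s - 1) * X s * (inverse (sqrt (X s)) / 2) * \<rho> (\<theta> s) + \<rho>' (\<theta> s) * X s * sqrt (X s)
        = - (X s - 1) * (X s * inverse (sqrt (X s))) * \<rho> (\<theta> s) + \<rho>' (\<theta> s) * X s * sqrt (X s)"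
      by simp
    also have "\<dots> = h' s" using X[OF s] unfolding r h'_def by (simp add: field_simps)
    finally have eq: "- 2 * (X s - 1) * X s * (inverse (sqrt (X s)) / 2) * \<rho> (\<theta> s)
      + \<rho>' (\<theta> s) * X s * sqrt (X s) = h' s" .
    show ?thesis
      using DERIV_add[OF DERIV_const[of c0] DERIV_mult[OF 2 1]]
      unfolding eq add_0 by (simp add: h_def X_def \<theta>_def)
  qed
  have h'0: "0 \<le> h' s" if s: "0 \<le> s" for s
  proof -
    have "(1 - 1 / X s) * \<rho> (\<theta> s) \<le> \<rho>' (\<theta> s)"
    proof (cases "1 < m")
      case True
      then show ?thesis using big[OF True \<theta>[OF s]] xi_flow_time[OF m s] by (simp add: X_def \<theta>_def)
    next
      case False
      then have "X s \<le> 1" using flow_den_pos[OF m s] False by (simp add: X_def flow_xi_def divide_simps) (simp add: flow_den_def)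
      then have "(1 - 1 / X s) * \<rho> (\<theta> s) \<le> 0"
        using X[OF s] \<rho>_mono[OF \<theta>[OF s]] by (intro mult_nonpos_nonneg) auto
      then show ?thesis using mono[OF \<theta>[OF s]] by linarith
    qed
    then show ?thesis using X[OF s] by (simp add: h'_def)
  qed
  show "0 \<le> x \<Longrightarrow> x \<le> y \<Longrightarrow> h x \<le> h y"
    using growth_of_derivative_ge[of x y h h' "{0..}" 0] dh h'0 by auto
  have ch': "continuous_on {0..} h'"
  proof -
    have c\<theta>: "continuous_on {0..} \<theta>"
      unfolding \<theta>_def using has_derivative_flow_time[OF m]
      by (intro DERIV_continuous_on[of _ _ "flow_xi m"]) auto
    have c\<rho>: "continuous_on {0..} \<rho>" using d\<rho> by (intro DERIV_continuous_on[of _ _ \<rho>']) auto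
    have "continuous_on {0..} (\<lambda>s. \<rho> (\<theta> s))" "continuous_on {0..} (\<lambda>s. \<rho>' (\<theta> s))"
      using \<theta> by (auto intro!: continuous_on_compose2[OF c\<rho> c\<theta>] continuous_on_compose2[OF cont c\<theta>])
    moreover have "continuous_on {0..} X" unfolding X_def by (intro continuous_on_flow_xi m order_refl)
    moreover have "X s \<noteq> 0" if "0 \<le> s" for s using X[OF that] by simp
    ultimately show ?thesis unfolding h'_def by (auto intro!: continuous_intros)
  qed
  assume s: "0 < s"
  have "0 < \<theta> (s / 2)" using flow_time_less_iff[OF m, of 0 "s / 2"] s by (simp add: \<theta>_def)
  have "0 < \<rho> (\<theta> (s / 2))"
  proof -
    \<comment> \<open>\<open>\<rho>\<close> is known to increase strictly only before
      \<open>t1\<close>; from \<open>b\<close> on, monotonicity preserves positivity.\<close>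
    define b where "b = min (t1 / 2) (\<theta> (s / 2))"
    have b: "0 < b" "b < t1" "b \<le> \<theta> (s / 2)" using pos(2) \<open>0 < \<theta> (s / 2)\<close> by (auto simp: b_def)
    obtain z where z: "0 < z" "z < b" "\<rho> b - \<rho> 0 = (b - 0) * \<rho>' z"
      using mvt_within[of 0 b \<rho> \<rho>' "{0..}"] d\<rho> b by (auto simp: mult.commute)
    have "0 < \<rho>' z" using pos(1) z b by simp
    then have "0 < \<rho> b" using z b \<rho>0 by simp
    moreover have "\<rho> b \<le> \<rho> (\<theta> (s / 2))"
      using growth_of_derivative_ge[of b "\<theta> (s / 2)" \<rho> \<rho>' "{0..}" 0] d\<rho> mono b by auto
    ultimately show ?thesis by simp
  qed
  then have "h 0 < h (s / 2)" using X[of "s / 2"] s \<rho>0 by (simp add: h_def X_def \<theta>_def)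
  \<comment> \<open>For m > 1 the hypotheses allow the derivative of h to vanish where \<rho>' is positive, so a time
    at which it is positive has to come from the strict increase of h.\<close>
  obtain a where "0 < a" "a < s / 2" "h (s / 2) - h 0 = h' a * (s / 2 - 0)"
    using mvt_within[of 0 "s / 2" h h' "{0..}"] dh s by auto
  then have a: "0 < a" "a < s / 2" "0 < h' a * (s / 2)" using \<open>h 0 < h (s / 2)\<close> by auto
  then have "0 < h' a" using s by (simp add: zero_less_mult_iff)
  then obtain d where d: "0 < d" "\<And>x. 0 \<le> x \<Longrightarrow> dist x a < d \<Longrightarrow> dist (h' x) (h' a) < h' a / 2"
    using ch' a(1) unfolding continuous_on_iff by (metis atLeast_iff half_gt_zero less_imp_le)
  define e where "e = min d (s / 2) / 4"
  have e: "0 < e" "2 * e < d" "a + 2 * e < s" using d s a by (auto simp: e_def)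
  have "h' a / 2 * (y - x) \<le> h y - h x" if "a \<le> x" "x \<le> y" "y \<le> a + 2 * e" for x y
  proof (rule growth_of_derivative_ge[of x y h h' "{0..}"])
    fix t assume "x \<le> t" "t \<le> y"
    then show "h' a / 2 \<le> h' t"
      using d(2)[of t] that a e by (auto simp: dist_real_def abs_if split: if_splits)
  qed (use that a dh in auto)
  then show "\<exists>a e c. 0 < a \<and> 0 < e \<and> a + 2 * e < s \<and> 0 < c \<and>
      (\<forall>x y. a \<le> x \<longrightarrow> x \<le> y \<longrightarrow> y \<le> a + 2 * e \<longrightarrow> c * (y - x) \<le> h y - h x)"
    using a(1) e \<open>0 < h' a\<close> by (intro exI[of _ a] exI[of _ e] exI[of _ "h' a / 2"]) auto
qed

text \<open>\<open>T\<close> is an arbitrary finite existence time. A solution restricts to shorter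
  intervals, so the maximal interval is covered even if it is infinite.\<close>

theorem theorem6p1:
  fixes r0 m T :: real and k :: nat
    and \<rho>d :: "nat \<Rightarrow> real \<Rightarrow> real"
    and v vt :: "real \<times> real \<Rightarrow> real \<Rightarrow> real"
    and G H1 H2 :: "real \<times> real \<Rightarrow> real \<Rightarrow> real \<times> real"
  assumes r0: "r0 > 0" and k: "k \<ge> 2" and m: "m > 0" "m \<noteq> 1"
    and rho_Ck: "\<forall>j<k. \<forall>t\<ge>0. (\<rho>d j has_real_derivative \<rho>d (Suc j) t) (at t within {0..})"
    and rho_cont: "continuous_on {0..} (\<rho>d k)"
    and rho_0: "\<forall>j\<le>k. \<rho>d j 0 = 0"
    and rho_mono: "\<forall>t\<ge>0. \<rho>d 1 t \<ge> 0"
    and rho_pos: "\<exists>t1>0. \<forall>t\<in>{0<..<t1}. \<rho>d 1 t > 0"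
    and rho_big_m: "m > 1 \<Longrightarrow> \<forall>t\<ge>0. \<rho>d 1 t \<ge> (1 - 1 / xi m t) * \<rho>d 0 t"
    and T: "T > 0"
    and reg: "C21_on (geo_ball r0) T v G H1 H2 vt"
    and flow: "\<forall>t\<in>{0..<T}. \<forall>p\<in>geo_ball r0.
                 vt p t = - (gauss_curv v H1 H2 p t + 1)"
    and bdry: "\<forall>t\<in>{0..<T}. \<forall>p. norm p = tanh (r0 / 2) \<longrightarrow>
                 geod_curv (tanh (r0 / 2)) v G p t = eta m r0 (\<rho>d 0) t"
    and init: "\<forall>p\<in>geo_ball r0. exp (2 * v p 0) = m * hyp_factor p"
  shows "(\<forall>p\<in>geo_ball r0. \<forall>t\<in>{0..<T}. gauss_curv v H1 H2 p t + 1 / xi m t \<le> 0) \<and>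
         (\<forall>p\<in>geo_ball r0. \<forall>t\<in>{0<..<T}. gauss_curv v H1 H2 p t + 1 / xi m t < 0)"
proof -
  define R where "R = tanh (r0 / 2)"
  have R: "0 < R" "R \<le> 1" using r0 tanh_real_lt_1[of "r0 / 2"] by (auto simp: R_def)
  have ball: "geo_ball r0 = cball 0 R" by (simp add: geo_ball_def R_def)
  obtain T' where T': "0 < T'" "flow_time m T' = T"
    using flow_time_surj[OF m(1), of T] T by (metis less_imp_le)
  define \<theta> where "\<theta> = flow_time m"
  define X where "X = flow_xi m"
  have \<theta>: "\<theta> s \<in> {0..<T}" if "s \<in> {0..<T'}" for s
    using flow_time_nonneg[OF m(1), of s] flow_time_less_iff[OF m(1), of s T'] that T'
    by (simp add: \<theta>_def)
  have X: "0 < X s" if "0 \<le> s" for s using flow_xi_pos[OF m(1) that] by (simp add: X_def)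
  \<comment> \<open>This is \<open>- ln (X s) / 2\<close> by \<open>ln_flow_xi\<close>, in a form
    whose derivative \<open>X s - 1\<close> is immediate; adding it to \<open>v\<close> divides the
    metric by \<open>X s\<close>.\<close>
  define f where "f s = \<theta> s - s - ln m / 2" for s
  have exp_f: "exp (f s) = 1 / sqrt (X s)" "exp (- 2 * f s) = X s" if s: "0 \<le> s" for s
  proof -
    have "- 2 * f s = ln (X s)" using ln_flow_xi[OF m(1) s] by (simp add: f_def X_def \<theta>_def)
    then show 1: "exp (- 2 * f s) = X s" using X[OF s] by simp
    have "(exp (- f s))\<^sup>2 = X s" by (subst 1[symmetric]) (simp add: power2_eq_square flip: exp_add)
    then have "sqrt (X s) = exp (- f s)" by (metis exp_ge_zero real_sqrt_unique)
    then show "exp (f s) = 1 / sqrt (X s)" by (simp add: exp_minus inverse_eq_divide)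
  qed
  define u where "u p s = v p (\<theta> s) + f s" for p s
  define ut where "ut p s = vt p (\<theta> s) * X s + (X s - 1)" for p s
  define h where "h s = cosh r0 / sinh r0 + sqrt (X s) * \<rho>d 0 (\<theta> s)" for s
  have d\<theta>: "(\<theta> has_real_derivative X s) (at s within {0..<T'})" if "s \<in> {0..<T'}" for s
    using has_derivative_flow_time[OF m(1), of s] that by (simp add: \<theta>_def X_def)
  have cX: "continuous_on {0..<T'} X"
    unfolding X_def by (rule continuous_on_flow_xi) (use m in auto)
  have reg_u: "C21_on (cball 0 R) T' u (\<lambda>p s. G p (\<theta> s)) (\<lambda>p s. H1 p (\<theta> s)) (\<lambda>p s. H2 p (\<theta> s)) ut"
    unfolding u_def ut_def
    by (rule C21_on_time_change[OF reg[unfolded ball] \<theta> d\<theta>])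
      (auto simp: f_def intro!: derivative_eq_intros d\<theta> cX continuous_intros)
  have K: "gauss_curv v H1 H2 p (\<theta> s) + 1 / xi m (\<theta> s) = - ut p s / X s"
    if "norm p \<le> R" "0 \<le> s" "s < T'" for p s
  proof -
    have "gauss_curv v H1 H2 p (\<theta> s) = - vt p (\<theta> s) - 1"
      using flow \<theta>[of s] that by (simp add: ball)
    moreover have "xi m (\<theta> s) = X s" using xi_flow_time[OF m(1) that(2)] by (simp add: X_def \<theta>_def)
    ultimately have "gauss_curv v H1 H2 p (\<theta> s) + 1 / xi m (\<theta> s) = - vt p (\<theta> s) - 1 + 1 / X s"
      by simp
    then show ?thesis using X[OF that(2)] by (simp add: ut_def) (simp add: field_simps)
  qed
  have rho1: "(\<rho>d 0 has_real_derivative \<rho>d 1 t) (at t within {0..})" if "0 \<le> t" for t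
    using rho_Ck k that by (metis One_nat_def Suc_le_lessD Suc_lessD numeral_2_eq_2)
  have rho2: "continuous_on {0..} (\<rho>d 1)"
    using rho_Ck k by (intro DERIV_continuous_on[of _ _ "\<rho>d (Suc 1)"]) auto
  have rho3: "\<rho>d 0 0 = 0" using rho_0 by simp
  obtain t1 where t1: "0 < t1" "\<And>t. 0 < t \<Longrightarrow> t < t1 \<Longrightarrow> 0 < \<rho>d 1 t" using rho_pos by auto
  note hh = monotone_boundary_data[OF m(1) rho1 rho2 rho3, where ?t1.0 = t1 and ?c0.0 = "cosh r0 / sinh r0",
      folded X_def \<theta>_def, folded h_def]
  have h_mono: "h x \<le> h y" if "0 \<le> x" "x \<le> y" for x y
    by (rule hh(1)) (use that t1 rho_mono rho_big_m in auto)
  have h_growth: "\<exists>a e c. 0 < a \<and> 0 < e \<and> a + 2 * e < s \<and> 0 < c \<and>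
      (\<forall>x y. a \<le> x \<longrightarrow> x \<le> y \<longrightarrow> y \<le> a + 2 * e \<longrightarrow> c * (y - x) \<le> h y - h x)" if "0 < s" for s
    by (rule hh(2)) (use that t1 rho_mono rho_big_m in auto)
  interpret flow_from_static R T' u ut "\<lambda>p s. G p (\<theta> s)" "\<lambda>p s. H1 p (\<theta> s)" "\<lambda>p s. H2 p (\<theta> s)" h
  proof
    fix p :: "real \<times> real" and s assume p: "norm p < R" and s: "0 \<le> s" "s < T'"
    have "- ut p s / X s = - exp (- 2 * v p (\<theta> s)) * (fst (H1 p (\<theta> s)) + snd (H2 p (\<theta> s))) + 1 / X s"
      using K[of p s] p s xi_flow_time[OF m(1) s(1)] by (simp add: gauss_curv_def X_def \<theta>_def)
    then have "ut p s = X s * exp (- 2 * v p (\<theta> s)) * (fst (H1 p (\<theta> s)) + snd (H2 p (\<theta> s))) - 1"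
      using X[OF s(1)] by (simp add: field_simps)
    moreover have "exp (- 2 * u p s) = X s * exp (- 2 * v p (\<theta> s))"
      using exp_f(2)[OF s(1)] by (simp add: u_def distrib_left exp_add exp_diff exp_minus field_simps)
    ultimately show "ut p s = exp (- 2 * u p s) * (fst (H1 p (\<theta> s)) + snd (H2 p (\<theta> s))) - 1" by simp
  next
    fix p :: "real \<times> real" and s assume p: "norm p = R" and s: "0 \<le> s" "s < T'"
    have xi: "xi m (\<theta> s) = X s" using xi_flow_time[OF m(1) s(1)] by (simp add: X_def \<theta>_def)
    have "exp (- v p (\<theta> s)) * (1 / R + G p (\<theta> s) \<bullet> (p /\<^sub>R R)) = eta m r0 (\<rho>d 0) (\<theta> s)"
      using bdry[rule_format, of "\<theta> s" p] \<theta>[of s] p s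
      by (simp add: geod_curv_def flip: R_def)
    moreover have "1 / R + G p (\<theta> s) \<bullet> (p /\<^sub>R R) = (G p (\<theta> s) \<bullet> p + 1) / R"
      using R by (simp add: field_simps)
    ultimately have "G p (\<theta> s) \<bullet> p + 1 = R * exp (v p (\<theta> s)) * eta m r0 (\<rho>d 0) (\<theta> s)"
      using R by (simp add: exp_minus field_simps)
    \<comment> \<open>Dividing a metric by \<open>X s\<close> multiplies geodesic curvature by
      \<open>sqrt (X s)\<close>, which cancels the factor in front of coth r0.\<close>
    moreover have "eta m r0 (\<rho>d 0) (\<theta> s) = h s * exp (f s)"
      using X[OF s(1)] by (simp add: eta_def xi h_def exp_f(1)[OF s(1)] field_simps)
    ultimately show "G p (\<theta> s) \<bullet> p + 1 = R * h s * exp (u p s)" by (simp add: u_def exp_add)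
  next
    fix p :: "real \<times> real" assume p: "norm p < R"
    have p1: "(norm p)\<^sup>2 < 1" using p R by (simp add: power_less_one_iff)
    have "exp (2 * v p 0) = m * hyp_factor p" using init p by (simp add: ball)
    \<comment> \<open>The initial curvature is thus -1/m = -1/xi(0): F_1 vanishes at time 0, which
      is stationarity after rescaling.\<close>
    then have "exp (- 2 * v p 0) * hyp_factor p = 1 / m"
      using p1 m(1) by (simp add: exp_minus hyp_factor_def)
    moreover have "fst (H1 p 0) + snd (H2 p 0) = hyp_factor p"
      by (rule hyp_factor_laplacian[OF reg[unfolded ball] T R(2) _ m(1) p]) (use init in \<open>simp add: ball\<close>)
    ultimately have "gauss_curv v H1 H2 p 0 = - 1 / m" by (simp add: gauss_curv_def)
    then have "ut p 0 / X 0 = 0"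
      using K[of p 0] p T' m by (simp add: \<theta>_def xi_def)
    then show "ut p 0 = 0" using X[of 0] by simp
  next
    show "0 \<le> h 0" using r0 rho3 by (simp add: h_def \<theta>_def)
  qed (use R reg_u h_mono in auto)
  have transfer: "\<exists>s. 0 \<le> s \<and> s < T' \<and> t = \<theta> s \<and> (0 < t \<longrightarrow> 0 < s)" if t: "t \<in> {0..<T}" for t
  proof -
    obtain s where s: "0 \<le> s" "flow_time m s = t" "0 < t \<Longrightarrow> 0 < s"
      using flow_time_surj[OF m(1), of t] t by auto
    then show ?thesis using flow_time_less_iff[OF m(1), of s T'] T' t by (auto simp: \<theta>_def)
  qed
  show ?thesis
  proof (intro conjI ballI)
    fix p t assume p: "p \<in> geo_ball r0" and "t \<in> {0..<T}"
    from transfer[OF this(2)] obtain s where s: "0 \<le> s" "s < T'" "t = \<theta> s" by blast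
    have "0 \<le> ut p s" using time_derivative_nonneg[of p s] p s by (simp add: ball)
    then show "gauss_curv v H1 H2 p t + 1 / xi m t \<le> 0"
      using K[of p s] p s X[of s] by (simp add: ball)
  next
    fix p t assume p: "p \<in> geo_ball r0" and t: "t \<in> {0<..<T}"
    then obtain s where s: "0 < s" "s < T'" "t = \<theta> s" using transfer[of t] by auto
    obtain a e c where "0 < a" "0 < e" "a + 2 * e < s" "0 < c"
      "\<And>x y. a \<le> x \<Longrightarrow> x \<le> y \<Longrightarrow> y \<le> a + 2 * e \<Longrightarrow> c * (y - x) \<le> h y - h x"
      using h_growth[OF s(1)] by blast
    then have "0 < ut p s" using time_derivative_pos[of p s a e c] p s by (simp add: ball)
    then show "gauss_curv v H1 H2 p t + 1 / xi m t < 0"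
      using K[of p s] p s X[of s] by (simp add: ball)
  qed
qed

end
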